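(* Let $I_0,I_1\subset\{1,\dots,m\}\times\{1,\dots,n\}$ be disjoint, let $F$ be the non-empty face of $[0,1]^{(m,n)}$ given by $(I_0,I_1)$, and write $P_O$ for the full orbitope $\mathcal{P}_0(m,n)$. Suppose $\mathrm{Fix}_F(P_O)\neq\varnothing$, and let $\underline{M}^1$ and $\overline{M}^n$ be the matrices constructed from $(I_0,I_1)$ as described in the context. For each $j\in\{1,\dots,n\}$ let $$i_j=\min\{\, i\in\{1,\dots,m\} : \underline{M}^1(i,j)\neq\overline{M}^n(i,j)\,\},$$ with $i_j=m+1$ if the columns $\underline{M}^1(j)$ and $\overline{M}^n(j)$ are equal. Then $\mathrm{Fix}_F(P_O)$ is the face given by the index sets $(I_0^{\star},I_1^{\star})$ with $I_0^{\star}=I_0\cup I_0^+$ and $I_1^{\star}=I_1\cup I_1^+$, where $$I_0^+=\{(i,j)\notin I_0\cup I_1 : i<i_j \text{ and } \overline{M}^n(i,j)=0\},$$ $$I_1^+=\{(i,j)\notin I_0\cup I_1 : i<i_j \text{ and } \underline{M}^1(i,j)=1\}.$$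
   Context: Lexicographic order: for $y,z\in\{0,1\}^m$, $y\succ z$ if there is a row $r\in\{1,\dots,m\}$ with $y_{r'}=z_{r'}$ for all $r'<r$ and $y_r=1$, $z_r=0$; $y\succeq z$ means $y=z$ or $y\succ z$. For a matrix $X$, $X(j)$ is its $j$-th column and $X(i,j)$ its entry in row $i$, column $j$. Full orbitope: $P_O=\mathcal{P}_0(m,n)$ is the convex hull of all $m\times n$ binary matrices $X$ with $X(j)\succeq X(j+1)$ for all $j<n$. Faces and fixing: the face of the cube $C^{(m,n)}=[0,1]^{(m,n)}$ given by $(I_0,I_1)$ is $F=\{x\in[0,1]^{(m,n)} : x_{i,j}=0\ \forall (i,j)\in I_0,\ x_{i,j}=1\ \forall (i,j)\in I_1\}$. For a polytope $P\subset C^{(m,n)}$, $\mathrm{Fix}_F(P)$ is the smallest face of $C^{(m,n)}$ containing $P\cap F\cap\{0,1\}^{(m,n)}$, i.e. the intersection of all faces of $C^{(m,n)}$ (including the empty face) containing that set. Partial matrices: a pair $(S_0,S_1)$ of index sets defines the partial matrix $M$ with entries in $\{0,1,\times\}$ that are $0$ on $S_0$, $1$ on $S_1$, and $\times$ (free) elsewhere. For $j<n$, a row $i$ of $M$ is $j$-fixed if $M(i,j)\ne\times$, $M(i,j+1)\neq\times$ and $M(i,j)\ne M(i,j+1)$; $i_f(M,j)$ is the smallest $j$-fixed row, or $m+1$ if there is none. A row $i$ is $j$-discriminating if $M(i,j)\neq 0$ and $M(i,j+1)\ne 1$; $i_d(M,j)$ is the largest $j$-discriminating row in $\{1,\dots,i_f(M,j)\}$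 if one exists, and $0$ otherwise. Failure pair: $S^{\varnothing}_0=\{(1,1)\}$, $S^{\varnothing}_1=(\{1,\dots,m\}\times\{1,\dots,n\})\setminus S^{\varnothing}_0$. Construction of $(\underline{S}^j_0,\underline{S}^j_1)$, with associated partial matrix $\underline{M}^j$: set $\underline{S}^n_1=I_1$ and $\underline{S}^n_0=I_0\cup\{(i,n) : (i,n)\notin I_1\}$. For $j=n-1,\dots,1$ let $i_f=i_f(\underline{M}^{j+1},j)$. (a) If $i_f=m+1$: $\underline{S}^j_1=\underline{S}^{j+1}_1\cup\{(i,j)\notin\underline{S}^{j+1}_0 : (i,j+1)\in\underline{S}^{j+1}_1\}$ and $\underline{S}^j_0=\underline{S}^{j+1}_0\cup\{(i,j)\notin\underline{S}^{j+1}_1 : (i,j+1)\in\underline{S}^{j+1}_0\}$. (b) Else, if $\underline{M}^{j+1}$ has no $j$-discriminating row in $\{1,\dots,i_f\}$: set $(\underline{S}^{j'}_0,\underline{S}^{j'}_1)=(S^{\varnothing}_0,S^{\varnothing}_1)$ for all $j'\le j$ and stop. (c) Else, with $i_d=i_d(\underline{M}^{j+1},j)$: $\underline{S}^j_1=\underline{S}^{j+1}_1\cup\{(i_d,j)\}\cup\{(i,j)\notin\underline{S}^{j+1}_0 : (i,j+1)\in\underline{S}^{j+1}_1,\ i<i_d\}$ and $\underline{S}^j_0=\underline{S}^{j+1}_0\cup\{(i,j) : (i,j)\notin\underline{S}^j_1\}$ ($i$ ranging over all rows). Construction of $(\overline{S}^j_0,\overline{S}^j_1)$, with associated partial matrix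 $\overline{M}^j$: set $\overline{S}^1_0=I_0$ and $\overline{S}^1_1=I_1\cup\{(i,1) : (i,1)\notin I_0\}$. For $j=2,\dots,n$ let $i_f=i_f(\overline{M}^{j-1},j-1)$. (a) If $i_f=m+1$: $\overline{S}^j_1=\overline{S}^{j-1}_1\cup\{(i,j)\notin\overline{S}^{j-1}_0 : (i,j-1)\in\overline{S}^{j-1}_1\}$ and $\overline{S}^j_0=\overline{S}^{j-1}_0\cup\{(i,j)\notin\overline{S}^{j-1}_1 : (i,j-1)\in\overline{S}^{j-1}_0\}$. (b) Else, if $\overline{M}^{j-1}$ has no $(j-1)$-discriminating row in $\{1,\dots,i_f\}$: set $(\overline{S}^{j'}_0,\overline{S}^{j'}_1)=(S^{\varnothing}_0,S^{\varnothing}_1)$ for all $j'\ge j$ and stop. (c) Else, with $i_d=i_d(\overline{M}^{j-1},j-1)$: $\overline{S}^j_0=\overline{S}^{j-1}_0\cup\{(i_d,j)\}\cup\{(i,j)\notin\overline{S}^{j-1}_1 : (i,j-1)\in\overline{S}^{j-1}_0,\ i<i_d\}$ and $\overline{S}^j_1=\overline{S}^{j-1}_1\cup\{(i,j) : (i,j)\notin\overline{S}^j_0\}$. *)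

theory Defs
  imports "HOL-Analysis.Analysis" "HOL-Library.Function_Algebras"
begin

text \<open>
  Since \<open>m\<close> and \<open>n\<close> are variables, an \<open>m \<times> n\<close> matrix is a function on pairs
  (row, column), with both indices starting at 1, that vanishes outside the index grid. The
  pointwise scalar multiplication makes \<^const>\<open>convex\<close>, \<open>convex hull\<close> and \<open>face_of\<close> available
  for such functions.
\<close>

instantiation "fun" :: (type, real_vector) real_vector
begin

definition scaleR_fun :: "real \<Rightarrow> ('a \<Rightarrow> 'b) \<Rightarrow> 'a \<Rightarrow> 'b" where
  "scaleR_fun c f = (\<lambda>x. c *\<^sub>R f x)"

instance
  by standard (auto simp: scaleR_fun_def fun_eq_iff scaleR_add_right scaleR_add_left)

end

type_synonym index = "nat \<times> nat"

definition grid :: "nat \<Rightarrow> nat \<Rightarrow> index set" where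
  "grid m n = {1..m} \<times> {1..n}"

definition cube :: "nat \<Rightarrow> nat \<Rightarrow> (index \<Rightarrow> real) set" where
  "cube m n = {x. (\<forall>p\<in>grid m n. 0 \<le> x p \<and> x p \<le> 1) \<and> (\<forall>p. p \<notin> grid m n \<longrightarrow> x p = 0)}"

definition binary_matrices :: "nat \<Rightarrow> nat \<Rightarrow> (index \<Rightarrow> real) set" where
  "binary_matrices m n =
     {x. (\<forall>p\<in>grid m n. x p = 0 \<or> x p = 1) \<and> (\<forall>p. p \<notin> grid m n \<longrightarrow> x p = 0)}"

definition cube_face :: "nat \<Rightarrow> nat \<Rightarrow> index set \<Rightarrow> index set \<Rightarrow> (index \<Rightarrow> real) set" where
  "cube_face m n I\<^sub>0 I\<^sub>1 = {x \<in> cube m n. (\<forall>p\<in>I\<^sub>0. x p = 0) \<and> (\<forall>p\<in>I\<^sub>1. x p = 1)}"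

definition lex_greater :: "nat \<Rightarrow> (nat \<Rightarrow> real) \<Rightarrow> (nat \<Rightarrow> real) \<Rightarrow> bool" where
  "lex_greater m y z \<longleftrightarrow>
     (\<exists>r\<in>{1..m}. (\<forall>r'\<in>{1..<r}. y r' = z r') \<and> y r = 1 \<and> z r = 0)"

definition lex_geq :: "nat \<Rightarrow> (nat \<Rightarrow> real) \<Rightarrow> (nat \<Rightarrow> real) \<Rightarrow> bool" where
  "lex_geq m y z \<longleftrightarrow> (\<forall>r\<in>{1..m}. y r = z r) \<or> lex_greater m y z"

definition full_orbitope :: "nat \<Rightarrow> nat \<Rightarrow> (index \<Rightarrow> real) set" where
  "full_orbitope m n =
     convex hull {X \<in> binary_matrices m n.
       \<forall>j. 1 \<le> j \<and> j < n \<longrightarrow> lex_geq m (\<lambda>i. X (i, j)) (\<lambda>i. X (i, j + 1))}"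

text \<open>
  The library's \<open>face_of\<close> counts the empty set and the whole cube as faces.
\<close>

definition Fix :: "nat \<Rightarrow> nat \<Rightarrow> (index \<Rightarrow> real) set \<Rightarrow> (index \<Rightarrow> real) set \<Rightarrow> (index \<Rightarrow> real) set" where
  "Fix m n F P = \<Inter> {G. G face_of cube m n \<and> P \<inter> F \<inter> binary_matrices m n \<subseteq> G}"

datatype entry = Zero | One | Free

type_synonym pmatrix = "nat \<Rightarrow> nat \<Rightarrow> entry"

text \<open>
  A pair of index sets is always given as \<open>(S\<^sub>0, S\<^sub>1)\<close>; the two sets are disjoint in every use.
\<close>

fun pmat :: "index set \<times> index set \<Rightarrow> pmatrix" where
  "pmat (S\<^sub>0, S\<^sub>1) i j = (if (i, j) \<in> S\<^sub>0 then Zero else if (i, j) \<in> S\<^sub>1 then One else Free)"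

definition fixed_row :: "pmatrix \<Rightarrow> nat \<Rightarrow> nat \<Rightarrow> bool" where
  "fixed_row M j i \<longleftrightarrow> M i j \<noteq> Free \<and> M i (j + 1) \<noteq> Free \<and> M i j \<noteq> M i (j + 1)"

definition i_f :: "nat \<Rightarrow> pmatrix \<Rightarrow> nat \<Rightarrow> nat" where
  "i_f m M j =
     (if \<exists>i\<in>{1..m}. fixed_row M j i then Min {i \<in> {1..m}. fixed_row M j i} else m + 1)"

definition discriminating_row :: "pmatrix \<Rightarrow> nat \<Rightarrow> nat \<Rightarrow> bool" where
  "discriminating_row M j i \<longleftrightarrow> M i j \<noteq> Zero \<and> M i (j + 1) \<noteq> One"

definition discriminating_rows :: "nat \<Rightarrow> pmatrix \<Rightarrow> nat \<Rightarrow> nat set" where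
  "discriminating_rows m M j = {i \<in> {1..m}. i \<le> i_f m M j \<and> discriminating_row M j i}"

definition i_d :: "nat \<Rightarrow> pmatrix \<Rightarrow> nat \<Rightarrow> nat" where
  "i_d m M j =
     (if discriminating_rows m M j \<noteq> {} then Max (discriminating_rows m M j) else 0)"

definition failure_pair :: "nat \<Rightarrow> nat \<Rightarrow> index set \<times> index set" where
  "failure_pair m n = ({(1, 1)}, grid m n - {(1, 1)})"

text \<open>
  The steps below return \<^const>\<open>None\<close> when the construction stops; the failure pair is only
  substituted afterwards, so that it is never processed as an ordinary intermediate pair.
\<close>

text \<open>From \<open>j + 1\<close> to \<open>j\<close>.\<close>

fun lower_step ::
  "nat \<Rightarrow> nat \<Rightarrow> index set \<times> index set \<Rightarrow> (index set \<times> index set) option" where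
  "lower_step m j (S\<^sub>0, S\<^sub>1) =
     (let M = pmat (S\<^sub>0, S\<^sub>1) in
      if i_f m M j = m + 1 then
        Some (S\<^sub>0 \<union> {(i, j) | i. i \<in> {1..m} \<and> (i, j) \<notin> S\<^sub>1 \<and> (i, j + 1) \<in> S\<^sub>0},
              S\<^sub>1 \<union> {(i, j) | i. i \<in> {1..m} \<and> (i, j) \<notin> S\<^sub>0 \<and> (i, j + 1) \<in> S\<^sub>1})
      else if discriminating_rows m M j = {} then None
      else
        (let d = i_d m M j;
             T\<^sub>1 = S\<^sub>1 \<union> {(d, j)} \<union>
               {(i, j) | i. i \<in> {1..m} \<and> (i, j) \<notin> S\<^sub>0 \<and> (i, j + 1) \<in> S\<^sub>1 \<and> i < d}
         in Some (S\<^sub>0 \<union> {(i, j) | i. i \<in> {1..m} \<and> (i, j) \<notin> T\<^sub>1}, T\<^sub>1)))"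

text \<open>From \<open>j\<close> to \<open>j + 1\<close>.\<close>

fun upper_step ::
  "nat \<Rightarrow> nat \<Rightarrow> index set \<times> index set \<Rightarrow> (index set \<times> index set) option" where
  "upper_step m j (S\<^sub>0, S\<^sub>1) =
     (let M = pmat (S\<^sub>0, S\<^sub>1) in
      if i_f m M j = m + 1 then
        Some (S\<^sub>0 \<union> {(i, j + 1) | i. i \<in> {1..m} \<and> (i, j + 1) \<notin> S\<^sub>1 \<and> (i, j) \<in> S\<^sub>0},
              S\<^sub>1 \<union> {(i, j + 1) | i. i \<in> {1..m} \<and> (i, j + 1) \<notin> S\<^sub>0 \<and> (i, j) \<in> S\<^sub>1})
      else if discriminating_rows m M j = {} then None
      else
        (let d = i_d m M j;
             T\<^sub>0 = S\<^sub>0 \<union> {(d, j + 1)} \<union>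
               {(i, j + 1) | i. i \<in> {1..m} \<and> (i, j + 1) \<notin> S\<^sub>1 \<and> (i, j) \<in> S\<^sub>0 \<and> i < d}
         in Some (T\<^sub>0, S\<^sub>1 \<union> {(i, j + 1) | i. i \<in> {1..m} \<and> (i, j + 1) \<notin> T\<^sub>0})))"

text \<open>After \<open>k\<close> steps \<open>lower_run\<close> is at column \<open>n - k\<close> and \<open>upper_run\<close> at column \<open>k + 1\<close>.\<close>

primrec lower_run ::
  "nat \<Rightarrow> nat \<Rightarrow> index set \<Rightarrow> index set \<Rightarrow> nat \<Rightarrow> (index set \<times> index set) option" where
  "lower_run m n I\<^sub>0 I\<^sub>1 0 = Some (I\<^sub>0 \<union> {(i, n) | i. i \<in> {1..m} \<and> (i, n) \<notin> I\<^sub>1}, I\<^sub>1)"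
| "lower_run m n I\<^sub>0 I\<^sub>1 (Suc k) = Option.bind (lower_run m n I\<^sub>0 I\<^sub>1 k) (lower_step m (n - Suc k))"

primrec upper_run ::
  "nat \<Rightarrow> index set \<Rightarrow> index set \<Rightarrow> nat \<Rightarrow> (index set \<times> index set) option" where
  "upper_run m I\<^sub>0 I\<^sub>1 0 = Some (I\<^sub>0, I\<^sub>1 \<union> {(i, 1) | i. i \<in> {1..m} \<and> (i, 1) \<notin> I\<^sub>0})"
| "upper_run m I\<^sub>0 I\<^sub>1 (Suc k) = Option.bind (upper_run m I\<^sub>0 I\<^sub>1 k) (upper_step m (Suc k))"

definition lower_sets ::
  "nat \<Rightarrow> nat \<Rightarrow> index set \<Rightarrow> index set \<Rightarrow> nat \<Rightarrow> index set \<times> index set" where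
  "lower_sets m n I\<^sub>0 I\<^sub>1 j =
     (case lower_run m n I\<^sub>0 I\<^sub>1 (n - j) of None \<Rightarrow> failure_pair m n | Some S \<Rightarrow> S)"

definition upper_sets ::
  "nat \<Rightarrow> nat \<Rightarrow> index set \<Rightarrow> index set \<Rightarrow> nat \<Rightarrow> index set \<times> index set" where
  "upper_sets m n I\<^sub>0 I\<^sub>1 j =
     (case upper_run m I\<^sub>0 I\<^sub>1 (j - 1) of None \<Rightarrow> failure_pair m n | Some S \<Rightarrow> S)"

definition lower_matrix :: "nat \<Rightarrow> nat \<Rightarrow> index set \<Rightarrow> index set \<Rightarrow> nat \<Rightarrow> pmatrix" where
  "lower_matrix m n I\<^sub>0 I\<^sub>1 j = pmat (lower_sets m n I\<^sub>0 I\<^sub>1 j)"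

definition upper_matrix :: "nat \<Rightarrow> nat \<Rightarrow> index set \<Rightarrow> index set \<Rightarrow> nat \<Rightarrow> pmatrix" where
  "upper_matrix m n I\<^sub>0 I\<^sub>1 j = pmat (upper_sets m n I\<^sub>0 I\<^sub>1 j)"

definition first_difference :: "nat \<Rightarrow> pmatrix \<Rightarrow> pmatrix \<Rightarrow> nat \<Rightarrow> nat" where
  "first_difference m A B j =
     (if \<exists>i\<in>{1..m}. A i j \<noteq> B i j then Min {i \<in> {1..m}. A i j \<noteq> B i j} else m + 1)"

end

theory Submission
  imports Defs
begin

text \<open>
  Let \<open>V\<close> be the set of binary matrices in the face \<open>F\<close> whose columns are lexicographically
  non-increasing. A binary point is an extreme point of the cube, so it lies in the convex hull
  of the sorted matrices only if it is one of them; hence \<open>V\<close> is the set of binary points of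
  \<open>F\<close> in the orbitope. The smallest face of the cube containing \<open>V\<close> fixes exactly those
  coordinates on which \<open>V\<close> is constant, because the average of \<open>V\<close> is strictly between 0 and 1
  in all other coordinates (\<open>smallest_cube_face_of_binary_set\<close>). It remains to find the
  coordinates on which \<open>V\<close> is constant.

  The two constructions are greedy. From right to left, each column of the lower matrix is the
  lexicographically smallest completion of the prescribed entries that is at least its right
  neighbour (\<open>best_least\<close>); by transitivity its column \<open>j\<close> is a lower bound for column \<open>j\<close> of
  every matrix in \<open>V\<close>. Dually, the upper matrix bounds every column from above. Both matrices
  are themselves in \<open>V\<close> (\<open>lower_matrix_extremal\<close>, \<open>upper_matrix_extremal\<close>).

  Above the first row in which the two bounds on column \<open>j\<close> differ, every matrix in \<open>V\<close> is
  squeezed between equal values (\<open>entry_forced_above_first_difference\<close>). At and below that row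
  no entry outside the prescribed ones is constant
  (\<open>entry_free_from_first_difference\<close>): a column \<open>y\<close> that differs from one of the bounds by a
  single flip still lies between them, and the matrix made of upper columns to the left of
  \<open>j\<close>, then \<open>y\<close>, then lower columns to the right, is sorted.

  Lexicographic arguments are carried out for columns with entries in \<^typ>\<open>entry\<close> and
  parametrised by a direction, so that the lower and the upper construction share one proof.
\<close>

section \<open>Faces of the cube spanned by binary points\<close>

lemma sum_fun_apply: "(\<Sum>x\<in>A. f x) p = (\<Sum>x\<in>A. f x p)"
  for f :: "'a \<Rightarrow> 'b \<Rightarrow> 'c::comm_monoid_add"
  by (induction A rule: infinite_finite_induct) auto

lemma convex_combination_apply:
  "((1 - u) *\<^sub>R a + u *\<^sub>R b) p = (1 - u) * a p + u * b p" for a b :: "'a \<Rightarrow> real"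
  by (simp add: scaleR_fun_def)

lemma convex_combination_eq_0:
  fixes a b u :: real
  assumes "(1 - u) * a + u * b = 0" "0 \<le> a" "0 \<le> b" "0 < u" "u < 1"
  shows "a = 0 \<and> b = 0"
proof -
  have "(1 - u) * a \<ge> 0" "u * b \<ge> 0" using assms by auto
  then have "(1 - u) * a = 0" "u * b = 0" using assms by linarith+
  then show ?thesis using assms by auto
qed

lemma convex_combination_eq_1:
  fixes a b u :: real
  assumes "(1 - u) * a + u * b = 1" "a \<le> 1" "b \<le> 1" "0 < u" "u < 1"
  shows "a = 1 \<and> b = 1"
  using convex_combination_eq_0[of u "1 - a" "1 - b"] assms by (simp add: algebra_simps)

lemma convex_cube: "convex (cube m n)"
proof (rule convexI)
  fix x y :: "index \<Rightarrow> real" and u w :: real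
  assume x: "x \<in> cube m n" and y: "y \<in> cube m n" and u: "0 \<le> u" "0 \<le> w" "u + w = 1"
  have "u * x p + w * y p \<le> u * 1 + w * 1" if "p \<in> grid m n" for p
    using x y u that by (intro add_mono mult_left_mono) (auto simp: cube_def)
  then show "u *\<^sub>R x + w *\<^sub>R y \<in> cube m n"
    using x y u by (auto simp: cube_def scaleR_fun_def)
qed

lemma cube_face_face_of_cube:
  assumes "I\<^sub>0 \<subseteq> grid m n" "I\<^sub>1 \<subseteq> grid m n"
  shows "cube_face m n I\<^sub>0 I\<^sub>1 face_of cube m n"
proof -
  have "convex (cube_face m n I\<^sub>0 I\<^sub>1)"
  proof (rule convexI)
    fix x y :: "index \<Rightarrow> real" and u w :: real
    assume "x \<in> cube_face m n I\<^sub>0 I\<^sub>1" "y \<in> cube_face m n I\<^sub>0 I\<^sub>1" "0 \<le> u" "0 \<le> w" "u + w = 1"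
    then show "u *\<^sub>R x + w *\<^sub>R y \<in> cube_face m n I\<^sub>0 I\<^sub>1"
      using convexD[OF convex_cube, of x m n y u w] by (simp add: cube_face_def scaleR_fun_def)
  qed
  moreover have "a \<in> cube_face m n I\<^sub>0 I\<^sub>1 \<and> b \<in> cube_face m n I\<^sub>0 I\<^sub>1"
    if ab: "a \<in> cube m n" "b \<in> cube m n" and x: "x \<in> cube_face m n I\<^sub>0 I\<^sub>1"
      and seg: "x \<in> open_segment a b" for a b x
  proof -
    obtain u where u: "0 < u" "u < 1" and xu: "x = (1 - u) *\<^sub>R a + u *\<^sub>R b"
      using seg by (auto simp: in_segment)
    have xp: "x p = (1 - u) * a p + u * b p" for p
      unfolding xu by (rule convex_combination_apply)
    have "a p = 0 \<and> b p = 0" if "p \<in> I\<^sub>0" for p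
    proof (rule convex_combination_eq_0[of u])
      show "(1 - u) * a p + u * b p = 0" using x that by (simp add: cube_face_def flip: xp)
    qed (use ab u that assms in \<open>auto simp: cube_def\<close>)
    moreover have "a p = 1 \<and> b p = 1" if "p \<in> I\<^sub>1" for p
    proof (rule convex_combination_eq_1[of u])
      show "(1 - u) * a p + u * b p = 1" using x that by (simp add: cube_face_def flip: xp)
    qed (use ab u that assms in \<open>auto simp: cube_def\<close>)
    ultimately show ?thesis using ab by (simp add: cube_face_def)
  qed
  moreover have "cube_face m n I\<^sub>0 I\<^sub>1 \<subseteq> cube m n" by (auto simp: cube_face_def)
  ultimately show ?thesis unfolding face_of_def by blast
qed

lemma finite_binary_matrices: "finite (binary_matrices m n)"
proof (rule finite_subset)
  show "binary_matrices m n \<subseteq> (\<lambda>S p. if p \<in> S then 1 else 0) ` Pow (grid m n)"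
  proof
    fix x assume "x \<in> binary_matrices m n"
    then have "x = (\<lambda>p. if p \<in> {p \<in> grid m n. x p = 1} then 1 else 0)"
      by (fastforce simp: binary_matrices_def)
    then show "x \<in> (\<lambda>S p. if p \<in> S then 1 else 0) ` Pow (grid m n)"
      by (intro image_eqI[of _ _ "{p \<in> grid m n. x p = 1}"]) auto
  qed
  show "finite ((\<lambda>S p. if p \<in> S then 1 else 0 :: real) ` Pow (grid m n))"
    by (intro finite_imageI) (simp add: grid_def)
qed

lemma binary_extreme_point_of_cube:
  assumes "x \<in> binary_matrices m n"
  shows "x extreme_point_of cube m n"
  unfolding extreme_point_of_def
proof (intro conjI ballI notI)
  show "x \<in> cube m n" using assms by (force simp: binary_matrices_def cube_def)
  fix a b assume ab: "a \<in> cube m n" "b \<in> cube m n" and seg: "x \<in> open_segment a b"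
  obtain u where u: "0 < u" "u < 1" and xu: "x = (1 - u) *\<^sub>R a + u *\<^sub>R b" and ne: "a \<noteq> b"
    using seg by (auto simp: in_segment)
  have xp: "x p = (1 - u) * a p + u * b p" for p
    unfolding xu by (rule convex_combination_apply)
  have "a p = b p" for p
  proof (cases "p \<in> grid m n")
    case True
    then have "x p = 0 \<or> x p = 1" using assms by (auto simp: binary_matrices_def)
    then show ?thesis
      using convex_combination_eq_0[of u "a p" "b p"] convex_combination_eq_1[of u "a p" "b p"]
        xp[of p] ab u True by (auto simp: cube_def)
  next
    case False
    then have "a p = 0" "b p = 0" using ab unfolding cube_def by blast+
    then show ?thesis by simp
  qed
  then show False using ne by auto
qed

lemma convex_hull_Int_binary_matrices:
  assumes "B \<subseteq> binary_matrices m n"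
  shows "convex hull B \<inter> binary_matrices m n = B"
proof (intro equalityI subsetI)
  fix x assume x: "x \<in> convex hull B \<inter> binary_matrices m n"
  have "B \<subseteq> cube m n"
    using assms binary_extreme_point_of_cube by (auto simp: extreme_point_of_def)
  then have "convex hull B \<subseteq> cube m n" by (simp add: convex_cube subset_hull)
  then have "x extreme_point_of (convex hull B)"
    using x binary_extreme_point_of_cube[of x m n] by (auto simp: extreme_point_of_def)
  then show "x \<in> B" by (rule extreme_point_of_convex_hull)
qed (use assms in \<open>auto simp: hull_inc\<close>)

text \<open>
  Averaging all points of \<open>V\<close> gives a point \<open>v\<close> whose coordinate is strictly between 0 and 1
  wherever \<open>V\<close> is not constant. From any \<open>y\<close> in the candidate face the segment through \<open>v\<close> can
  therefore be prolonged inside the cube, so a face containing \<open>v\<close> must contain \<open>y\<close>.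
\<close>

lemma smallest_cube_face_of_binary_set:
  assumes V: "V \<subseteq> binary_matrices m n" and ne: "V \<noteq> {}"
  shows "\<Inter> {G. G face_of cube m n \<and> V \<subseteq> G} =
    cube_face m n {p \<in> grid m n. \<forall>x\<in>V. x p = 0} {p \<in> grid m n. \<forall>x\<in>V. x p = 1}"
    (is "_ = cube_face m n ?J0 ?J1")
proof (intro equalityI)
  have "V \<subseteq> cube_face m n ?J0 ?J1"
    using V by (force simp: cube_face_def cube_def binary_matrices_def)
  moreover have "cube_face m n ?J0 ?J1 face_of cube m n"
    by (rule cube_face_face_of_cube) auto
  ultimately show "\<Inter> {G. G face_of cube m n \<and> V \<subseteq> G} \<subseteq> cube_face m n ?J0 ?J1" by blast
next
  have fin: "finite V" using V finite_binary_matrices finite_subset by blast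
  define t :: real where "t = 1 / card V"
  have card: "card V \<ge> 1" using fin ne by (simp add: Suc_leI card_gt_0_iff)
  then have t: "0 < t" "t \<le> 1" "t * card V = 1" by (auto simp: t_def)
  define v where "v = (\<Sum>x\<in>V. t *\<^sub>R x)"
  have vp: "v p = (\<Sum>x\<in>V. t * x p)" for p by (simp add: v_def sum_fun_apply scaleR_fun_def)
  have bin: "x p = 0 \<or> x p = 1" if "x \<in> V" for x p
    using V that unfolding binary_matrices_def by blast
  have bin01: "0 \<le> x p" "x p \<le> 1" if "x \<in> V" for x p
    using bin[OF that, of p] by auto
  have v_lower: "t \<le> v p" if "x \<in> V" "x p = 1" for x p
  proof -
    have "t * x p \<le> v p"
      unfolding vp using fin that t bin01 by (intro member_le_sum) auto
    then show ?thesis using that by simp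
  qed
  have v_upper: "v p \<le> 1 - t" if "x \<in> V" "x p = 0" for x p
  proof -
    have "t * (1 - x p) \<le> (\<Sum>x\<in>V. t * (1 - x p))"
      using fin that t bin01 by (intro member_le_sum) auto
    also have "\<dots> = 1 - v p"
      using t by (simp add: vp algebra_simps sum_subtractf)
    finally show ?thesis using that by simp
  qed
  show "cube_face m n ?J0 ?J1 \<subseteq> \<Inter> {G. G face_of cube m n \<and> V \<subseteq> G}"
  proof safe
    fix y G assume y: "y \<in> cube_face m n ?J0 ?J1" and G: "G face_of cube m n" and VG: "V \<subseteq> G"
    have y0: "y p = 0" if "p \<in> ?J0" for p using y that unfolding cube_face_def by blast
    have y1: "y p = 1" if "p \<in> ?J1" for p using y that unfolding cube_face_def by blast
    have "v \<in> G"
      unfolding v_def using G VG fin t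
      by (intro convex_sum) (auto simp: face_of_def mult.commute)
    define z where "z = v + t *\<^sub>R (v - y)"
    have zp: "z p = v p + t * (v p - y p)" for p by (simp add: z_def scaleR_fun_def)
    have z: "z \<in> cube m n"
      unfolding cube_def
    proof (intro CollectI conjI ballI allI impI)
      fix p assume p: "p \<in> grid m n"
      have y01: "0 \<le> y p" "y p \<le> 1" using y p by (auto simp: cube_face_def cube_def)
      consider "p \<in> ?J0" | "p \<in> ?J1" | "p \<notin> ?J0" "p \<notin> ?J1" by blast
      then have "0 \<le> z p \<and> z p \<le> 1"
      proof cases
        case 1
        then have "y p = 0" "v p = 0" using y0 by (auto simp: vp intro!: sum.neutral)
        then show ?thesis by (simp add: zp)
      next
        case 2
        then have "v p = (\<Sum>x\<in>V. t)" unfolding vp by (intro sum.cong) auto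
        then have "y p = 1" "v p = 1" using y1 t 2 by (simp_all add: mult.commute)
        then show ?thesis by (simp add: zp)
      next
        case 3
        then have "t \<le> v p" "v p \<le> 1 - t" using v_lower v_upper bin p by blast+
        moreover have "t * (- 1) \<le> t * (v p - y p)" "t * (v p - y p) \<le> t * 1"
          using t y01 calculation by (intro mult_left_mono; linarith)+
        ultimately show ?thesis unfolding zp by linarith
      qed
      then show "0 \<le> z p" "z p \<le> 1" by auto
    next
      fix p assume "p \<notin> grid m n"
      then have "v p = 0" "y p = 0"
        using y V unfolding vp cube_face_def cube_def binary_matrices_def
        by (auto simp del: split_paired_All intro!: sum.neutral)
      then show "z p = 0" by (simp add: zp)
    qed
    show "y \<in> G"
    proof (cases "y = v")
      case True
      then show ?thesis using \<open>v \<in> G\<close> by simp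
    next
      case False
      have "v = (1 - 1 / (1 + t)) *\<^sub>R y + (1 / (1 + t)) *\<^sub>R z"
      proof
        fix p
        have "(1 + t) * v p = t * y p + z p" by (simp add: zp algebra_simps)
        then have "v p = (t * y p + z p) / (1 + t)" using t by (simp add: field_simps)
        moreover have "1 - 1 / (1 + t) = t / (1 + t)" using t by (simp add: field_simps)
        ultimately have "v p = (1 - 1 / (1 + t)) * y p + (1 / (1 + t)) * z p"
          by (simp add: add_divide_distrib)
        then show "v p = ((1 - 1 / (1 + t)) *\<^sub>R y + (1 / (1 + t)) *\<^sub>R z) p"
          unfolding convex_combination_apply .
      qed
      moreover have "y \<noteq> z"
      proof
        assume "y = z"
        then have "(1 + t) * (v p - y p) = 0" for p using zp[of p] by (simp add: algebra_simps)
        then show False using False t by (auto simp: fun_eq_iff)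
      qed
      ultimately have "v \<in> open_segment y z"
        using t unfolding in_segment by (auto intro!: exI[of _ "1 / (1 + t)"])
      then show ?thesis
        using G z y \<open>v \<in> G\<close> unfolding face_of_def cube_face_def by blast
    qed
  qed
qed

section \<open>Greedy completion of a single column\<close>

type_synonym column = "nat \<Rightarrow> entry"

fun opposite :: "entry \<Rightarrow> entry" where
  "opposite Zero = One" | "opposite One = Zero" | "opposite Free = Free"

lemma opposite_opposite [simp]: "opposite (opposite v) = v" by (cases v) auto

lemma opposite_eq_self [simp]: "opposite v = v \<longleftrightarrow> v = Free" by (cases v) auto

lemma self_eq_opposite [simp]: "v = opposite v \<longleftrightarrow> v = Free" by (cases v) auto

lemma opposite_eq_Free [simp]: "opposite v = Free \<longleftrightarrow> v = Free" by (cases v) auto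

lemma eq_opposite_iff: "v \<noteq> Free \<Longrightarrow> x = opposite v \<longleftrightarrow> x \<noteq> v \<and> x \<noteq> Free"
  by (cases v; cases x) auto

text \<open>
  The value \<open>v\<close> sets the direction: for \<^const>\<open>One\<close> this is the lexicographic order on columns,
  for \<^const>\<open>Zero\<close> its reverse. All facts about columns hold in both directions, so the minimal
  and the maximal matrix are instances of the same construction.
\<close>

definition lex_ge :: "entry \<Rightarrow> nat \<Rightarrow> column \<Rightarrow> column \<Rightarrow> bool" where
  "lex_ge v m y z \<longleftrightarrow> (\<forall>i\<in>{1..m}. y i = z i) \<or>
     (\<exists>r\<in>{1..m}. (\<forall>i\<in>{1..<r}. y i = z i) \<and> y r = v \<and> z r = opposite v)"

text \<open>
  Here \<open>a\<close> is the partial column to be completed and \<open>z\<close> its finished neighbour. A turning row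
  is one in which a completion of \<open>a\<close> that agrees with \<open>z\<close> so far can overtake \<open>z\<close>; the pivot
  is the last of these. If nothing clashes, \<open>z\<close> can be copied entirely, which the pivot \<open>m + 1\<close>
  encodes.
\<close>

definition clashes :: "nat \<Rightarrow> column \<Rightarrow> column \<Rightarrow> nat set" where
  "clashes m a z = {i \<in> {1..m}. a i \<noteq> Free \<and> z i \<noteq> Free \<and> a i \<noteq> z i}"

definition turning_rows :: "entry \<Rightarrow> nat \<Rightarrow> column \<Rightarrow> column \<Rightarrow> nat set" where
  "turning_rows v m a z =
     {i \<in> {1..m}. (\<forall>k\<in>clashes m a z. i \<le> k) \<and> a i \<noteq> opposite v \<and> z i \<noteq> v}"

definition stuck :: "entry \<Rightarrow> nat \<Rightarrow> column \<Rightarrow> column \<Rightarrow> bool" where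
  "stuck v m a z \<longleftrightarrow> clashes m a z \<noteq> {} \<and> turning_rows v m a z = {}"

definition pivot :: "entry \<Rightarrow> nat \<Rightarrow> column \<Rightarrow> column \<Rightarrow> nat" where
  "pivot v m a z = (if clashes m a z = {} then m + 1 else Max (turning_rows v m a z))"

definition best :: "entry \<Rightarrow> nat \<Rightarrow> column \<Rightarrow> column \<Rightarrow> column" where
  "best v m a z i =
     (if a i \<noteq> Free then a i else if i < pivot v m a z then z i
      else if i = pivot v m a z then v else opposite v)"

definition completes :: "nat \<Rightarrow> column \<Rightarrow> column \<Rightarrow> bool" where
  "completes m a y \<longleftrightarrow> (\<forall>i\<in>{1..m}. y i \<noteq> Free \<and> (a i \<noteq> Free \<longrightarrow> y i = a i))"

lemma lex_ge_opposite: "lex_ge (opposite v) m y z \<longleftrightarrow> lex_ge v m z y"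
proof -
  have "(\<forall>i\<in>A. y i = z i) = (\<forall>i\<in>A. z i = y i)" for A by auto
  then show ?thesis unfolding lex_ge_def opposite_opposite by blast
qed

lemma lex_ge_trans:
  assumes "v \<noteq> Free" "lex_ge v m x y" "lex_ge v m y z"
  shows "lex_ge v m x z"
proof -
  consider "\<forall>i\<in>{1..m}. x i = y i" | "\<forall>i\<in>{1..m}. y i = z i"
    | r s where "r \<in> {1..m}" "\<forall>i\<in>{1..<r}. x i = y i" "x r = v" "y r = opposite v"
        "s \<in> {1..m}" "\<forall>i\<in>{1..<s}. y i = z i" "y s = v" "z s = opposite v"
    using assms(2,3) unfolding lex_ge_def by blast
  then show ?thesis
  proof cases
    case 1
    then have "lex_ge v m x z \<longleftrightarrow> lex_ge v m y z" unfolding lex_ge_def by auto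
    then show ?thesis using assms by simp
  next
    case 2
    then have "lex_ge v m x z \<longleftrightarrow> lex_ge v m x y" unfolding lex_ge_def by auto
    then show ?thesis using assms by simp
  next
    case 3
    have "r \<noteq> s" using 3(4,7) assms(1) by auto
    then consider "r < s" | "s < r" by linarith
    then show ?thesis
    proof cases
      case 1
      then have "\<forall>i\<in>{1..<r}. x i = z i" "z r = opposite v" using 3(1,2,4,6) by auto
      then show ?thesis using 3(1,3) unfolding lex_ge_def by blast
    next
      case 2
      then have "\<forall>i\<in>{1..<s}. x i = z i" "x s = v" using 3(2,5,6,7) by auto
      then show ?thesis using 3(5,8) unfolding lex_ge_def by blast
    qed
  qed
qed

text \<open>
  For filling free rows with the smaller value: the first row in which a completion differs from
  the filled column is one where the completion has the larger value.
\<close>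

lemma lex_ge_of_opposite_deviations:
  assumes v: "v \<noteq> Free" and y: "completes m a y"
    and x: "\<And>i. i \<in> {1..m} \<Longrightarrow> x i = y i \<or> x i = opposite v"
  shows "lex_ge v m y x"
proof (cases "\<forall>i\<in>{1..m}. y i = x i")
  case True
  then show ?thesis by (simp add: lex_ge_def)
next
  case False
  define s where "s = (LEAST i. i \<in> {1..m} \<and> y i \<noteq> x i)"
  have s: "s \<in> {1..m}" "y s \<noteq> x s"
    unfolding s_def using LeastI_ex[of "\<lambda>i. i \<in> {1..m} \<and> y i \<noteq> x i"] False by blast+
  have before: "\<forall>i\<in>{1..<s}. y i = x i"
    using not_less_Least[of _ "\<lambda>i. i \<in> {1..m} \<and> y i \<noteq> x i"] s(1)
    unfolding s_def[symmetric] by auto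
  have xs: "x s = opposite v" using x[of s] s by auto
  moreover have "y s = v"
    using s y eq_opposite_iff[OF v, of "y s"] unfolding xs completes_def by blast
  ultimately show ?thesis unfolding lex_ge_def using s(1) before by blast
qed

text \<open>
  If \<open>y\<close> first overtook \<open>z\<close> in a row where \<open>x\<close> still agrees with \<open>z\<close>, then \<open>y\<close> would also
  have overtaken \<open>x\<close>.
\<close>

lemma lex_ge_squeeze:
  assumes v: "v \<noteq> Free" and xy: "lex_ge v m x y" and yz: "lex_ge v m y z"
    and eq: "\<And>k. k \<in> {1..i} \<Longrightarrow> x k = z k" and i: "i \<in> {1..m}"
  shows "y i = z i"
proof (rule ccontr)
  assume ne: "y i \<noteq> z i"
  obtain s where s: "s \<in> {1..m}" "\<forall>k\<in>{1..<s}. y k = z k" "y s = v" "z s = opposite v"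
    using yz ne i unfolding lex_ge_def by blast
  have "s \<le> i" using s ne i by force
  then have xs: "x s = opposite v" using eq s by auto
  then have "x s \<noteq> y s" using s(3) v by simp
  then obtain r where r: "r \<in> {1..m}" "\<forall>k\<in>{1..<r}. x k = y k" "x r = v" "y r = opposite v"
    using xy s(1) unfolding lex_ge_def by blast
  have "r < s"
  proof (rule ccontr)
    assume "\<not> r < s"
    then have "r = s" using r(2) s(1) \<open>x s \<noteq> y s\<close> by force
    then show False using r(4) s(3) v by simp
  qed
  then have "x r = z r" "y r = z r" using r(1) s(2) eq[of r] \<open>s \<le> i\<close> by auto
  then show False using r(3,4) v by simp
qed

lemma best_completes:
  assumes "v \<noteq> Free" "completes m b z"
  shows "completes m a (best v m a z)"
  using assms unfolding completes_def best_def by simp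

text \<open>
  A completion that beats \<open>z\<close> must first deviate from \<open>z\<close> in a turning row, since past the first
  clash it is too late.
\<close>

lemma first_deviation:
  assumes v: "v \<noteq> Free" and y: "completes m a y" and z: "completes m b z" and ge: "lex_ge v m y z"
    and clash: "clashes m a z \<noteq> {}"
  obtains r where "r \<in> turning_rows v m a z" "\<forall>i\<in>{1..<r}. y i = z i" "y r = v" "z r = opposite v"
proof -
  have clash_dev: "y k \<noteq> z k" if "k \<in> clashes m a z" for k
    using that y by (auto simp: clashes_def completes_def)
  then have "\<exists>i\<in>{1..m}. y i \<noteq> z i" using clash unfolding clashes_def by blast
  then obtain r where r: "r \<in> {1..m}" "\<forall>i\<in>{1..<r}. y i = z i" "y r = v" "z r = opposite v"
    using ge unfolding lex_ge_def by blast
  have "r \<le> k" if "k \<in> clashes m a z" for k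
    using clash_dev[OF that] r that unfolding clashes_def by force
  moreover have "a r \<noteq> opposite v"
  proof
    assume "a r = opposite v"
    then have "y r = opposite v" using y r(1) v unfolding completes_def by force
    then show False using r(3) v by simp
  qed
  moreover have "z r \<noteq> v" using r(4) v by simp
  ultimately have "r \<in> turning_rows v m a z" using r by (simp add: turning_rows_def)
  then show ?thesis using r that by blast
qed

lemma not_stuck:
  assumes "v \<noteq> Free" "completes m a y" "completes m b z" "lex_ge v m y z"
  shows "\<not> stuck v m a z"
  using first_deviation[OF assms] unfolding stuck_def by blast

text \<open>
  Above the pivot the best column copies \<open>z\<close>; at the pivot it overtakes \<open>z\<close>, after which every
  free entry can take the smaller value.
\<close>

lemma best_rows:
  assumes v: "v \<noteq> Free" and z: "completes m b z" and ns: "\<not> stuck v m a z"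
    and clash: "clashes m a z \<noteq> {}"
  defines "d \<equiv> pivot v m a z"
  shows "d \<in> {1..m}" "z d = opposite v" "best v m a z d = v"
    and "\<And>i. i \<in> {1..<d} \<Longrightarrow> best v m a z i = z i"
    and "\<And>i. i \<in> {d<..m} \<Longrightarrow> best v m a z i = (if a i \<noteq> Free then a i else opposite v)"
    and "\<And>r. r \<in> turning_rows v m a z \<Longrightarrow> r \<le> d"
proof -
  have fin: "finite (turning_rows v m a z)" by (simp add: turning_rows_def)
  then have d: "d \<in> turning_rows v m a z"
    using ns clash by (auto simp: d_def pivot_def stuck_def)
  then show dm: "d \<in> {1..m}" by (simp add: turning_rows_def)
  have "a d \<noteq> opposite v" "z d \<noteq> v" "z d \<noteq> Free"
    using d z dm by (simp_all add: turning_rows_def completes_def)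
  then have "a d \<noteq> Free \<Longrightarrow> a d = v" "z d = opposite v" using v by (simp_all add: eq_opposite_iff)
  then show "z d = opposite v" "best v m a z d = v" by (auto simp: best_def d_def[symmetric])
  show "best v m a z i = z i" if "i \<in> {1..<d}" for i
  proof -
    have "i \<notin> clashes m a z" using d that by (force simp: turning_rows_def)
    then show ?thesis
      using that dm z by (auto simp: clashes_def best_def completes_def d_def[symmetric])
  qed
  show "best v m a z i = (if a i \<noteq> Free then a i else opposite v)" if "i \<in> {d<..m}" for i
    using that by (auto simp: best_def d_def[symmetric])
  show "r \<le> d" if "r \<in> turning_rows v m a z" for r
    using that fin clash by (simp add: d_def pivot_def)
qed

lemma best_eq_source:
  assumes "completes m b z" "clashes m a z = {}" "i \<in> {1..m}"
  shows "best v m a z i = z i"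
  using assms by (auto simp: clashes_def best_def pivot_def completes_def)

lemma best_lex_ge:
  assumes v: "v \<noteq> Free" and z: "completes m b z" and ns: "\<not> stuck v m a z"
  shows "lex_ge v m (best v m a z) z"
proof (cases "clashes m a z = {}")
  case True
  then show ?thesis using best_eq_source[OF z] by (auto simp: lex_ge_def)
next
  case False
  then show ?thesis
    unfolding lex_ge_def using best_rows(1-4)[OF v z ns False] by blast
qed

text \<open>
  Overtaking as late as possible makes the best column extremal: a competitor that deviates from
  \<open>z\<close> before the pivot is already ahead there, and one that deviates at the pivot cannot fall
  behind below it.
\<close>

lemma best_least:
  assumes v: "v \<noteq> Free" and z: "completes m b z" and ns: "\<not> stuck v m a z"
    and y: "completes m a y" and ge: "lex_ge v m y z"
  shows "lex_ge v m y (best v m a z)"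
proof (cases "clashes m a z = {}")
  case True
  then show ?thesis using best_eq_source[OF z] ge by (simp add: lex_ge_def)
next
  case False
  define d where "d = pivot v m a z"
  note best = best_rows[OF v z ns False, folded d_def]
  obtain r where r: "r \<in> turning_rows v m a z" "\<forall>i\<in>{1..<r}. y i = z i" "y r = v"
      "z r = opposite v"
    using first_deviation[OF v y z ge False] .
  have rm: "r \<in> {1..m}" using r by (simp add: turning_rows_def)
  show ?thesis
  proof (cases "r < d")
    case True
    then have "\<forall>i\<in>{1..<r}. y i = best v m a z i" "best v m a z r = opposite v"
      using r rm best(4) by auto
    then show ?thesis unfolding lex_ge_def using r rm by blast
  next
    case False
    then have rd: "r = d" using best(6)[OF r(1)] by simp
    have upto: "y i = best v m a z i" if "i \<in> {1..d}" for i
      using that r rd best(3,4) by (cases "i = d") auto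
    have "best v m a z i = y i \<or> best v m a z i = opposite v" if "i \<in> {1..m}" for i
      using upto[of i] best(5)[of i] that y unfolding completes_def by (cases "i \<le> d") auto
    then show ?thesis by (rule lex_ge_of_opposite_deviations[OF v y])
  qed
qed

lemma
  assumes a: "\<And>i. i \<in> {1..m} \<Longrightarrow> a i = a' i" and z: "\<And>i. i \<in> {1..m} \<Longrightarrow> z i = z' i"
  shows stuck_cong: "stuck v m a z = stuck v m a' z'"
    and best_cong: "i \<in> {1..m} \<Longrightarrow> best v m a z i = best v m a' z' i"
proof -
  have "clashes m a z = clashes m a' z'" using a z by (auto simp: clashes_def)
  moreover from this have "turning_rows v m a z = turning_rows v m a' z'"
    using a z by (auto simp: turning_rows_def)
  ultimately show "stuck v m a z = stuck v m a' z'"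
    and "i \<in> {1..m} \<Longrightarrow> best v m a z i = best v m a' z' i"
    using a z by (simp_all add: best_def pivot_def stuck_def)
qed

section \<open>Greedy completion of a sequence of columns\<close>

primrec greedy :: "entry \<Rightarrow> nat \<Rightarrow> (nat \<Rightarrow> column) \<Rightarrow> nat \<Rightarrow> column" where
  "greedy v m a 0 = (\<lambda>i. if a 0 i \<noteq> Free then a 0 i else opposite v)"
| "greedy v m a (Suc k) = best v m (a (Suc k)) (greedy v m a k)"

lemma greedy_completes: "v \<noteq> Free \<Longrightarrow> completes m (a k) (greedy v m a k)"
proof (induction k)
  case 0
  then show ?case by (auto simp: completes_def)
next
  case (Suc k)
  then show ?case by (auto intro: best_completes)
qed

text \<open>
  Any sorted completion \<open>y\<close> witnesses that the greedy process cannot get stuck, and stays on the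
  far side of it: \<open>y (Suc k)\<close> beats \<open>y k\<close>, hence the greedy column at \<open>k\<close>, hence the best
  completion relative to that column.
\<close>

lemma greedy_extremal:
  assumes v: "v \<noteq> Free" and y: "\<And>k. k < n \<Longrightarrow> completes m (a k) (y k)"
    and sorted: "\<And>k. Suc k < n \<Longrightarrow> lex_ge v m (y (Suc k)) (y k)"
  shows "k < n \<Longrightarrow> lex_ge v m (y k) (greedy v m a k)"
    and "Suc k < n \<Longrightarrow> \<not> stuck v m (a (Suc k)) (greedy v m a k)"
    and "Suc k < n \<Longrightarrow> lex_ge v m (greedy v m a (Suc k)) (greedy v m a k)"
proof -
  have ns: "\<not> stuck v m (a (Suc k)) (greedy v m a k) \<and> lex_ge v m (y (Suc k)) (greedy v m a k)"
    if "Suc k < n" "lex_ge v m (y k) (greedy v m a k)" for k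
    using that lex_ge_trans[OF v sorted[of k]] not_stuck[OF v y greedy_completes[OF v]] by blast
  have below: "k < n \<Longrightarrow> lex_ge v m (y k) (greedy v m a k)" for k
  proof (induction k)
    case 0
    then show ?case using y[of 0] by (auto simp: completes_def intro!: lex_ge_of_opposite_deviations[OF v y[of 0]])
  next
    case (Suc k)
    then show ?case
      using ns[of k] best_least[OF v greedy_completes[OF v] _ y[of "Suc k"]] by simp
  qed
  then show "k < n \<Longrightarrow> lex_ge v m (y k) (greedy v m a k)" .
  show "Suc k < n \<Longrightarrow> \<not> stuck v m (a (Suc k)) (greedy v m a k)" using ns below by simp
  then show "Suc k < n \<Longrightarrow> lex_ge v m (greedy v m a (Suc k)) (greedy v m a k)"
    using best_lex_ge[OF v greedy_completes[OF v]] by simp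
qed

section \<open>The two constructions are greedy completions\<close>

declare pmat.simps [simp del]

lemma lex_ge_cong:
  assumes "\<And>i. i \<in> {1..m} \<Longrightarrow> y i = y' i" "\<And>i. i \<in> {1..m} \<Longrightarrow> z i = z' i"
  shows "lex_ge v m y z = lex_ge v m y' z'"
  unfolding lex_ge_def using assms by (intro disj_cong bex_cong ball_cong conj_cong) auto

lemma clashes_commute: "clashes m a z = clashes m z a"
  by (auto simp: clashes_def)

lemma turning_rows_Zero: "turning_rows Zero m a z = turning_rows One m z a"
  by (auto simp: turning_rows_def clashes_commute[of m a z])

text \<open>
  Clashes are the fixed rows and turning rows the discriminating rows, for either choice of which
  of the two columns is the finished one: discriminating means \<open>M i j \<noteq> Zero\<close> and
  \<open>M i (j + 1) \<noteq> One\<close>, and exchanging the columns together with the values preserves this.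
\<close>

lemma i_f_eq:
  "i_f m M j = (let C = clashes m (\<lambda>i. M i j) (\<lambda>i. M i (j + 1)) in
     if C = {} then m + 1 else Min C)"
proof -
  have "{i \<in> {1..m}. fixed_row M j i} = clashes m (\<lambda>i. M i j) (\<lambda>i. M i (j + 1))"
    by (auto simp: clashes_def fixed_row_def)
  moreover from this have "(\<exists>i\<in>{1..m}. fixed_row M j i) \<longleftrightarrow>
      clashes m (\<lambda>i. M i j) (\<lambda>i. M i (j + 1)) \<noteq> {}" by blast
  ultimately show ?thesis unfolding i_f_def Let_def by simp
qed

lemma discriminating_rows_eq:
  "discriminating_rows m M j = turning_rows One m (\<lambda>i. M i j) (\<lambda>i. M i (j + 1))"
proof -
  let ?C = "clashes m (\<lambda>i. M i j) (\<lambda>i. M i (j + 1))"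
  have "finite ?C" by (simp add: clashes_def)
  then have "i \<le> i_f m M j \<longleftrightarrow> (\<forall>k\<in>?C. i \<le> k)" if "i \<in> {1..m}" for i
    using that by (simp add: i_f_eq Let_def)
  then show ?thesis
    by (auto simp: discriminating_rows_def turning_rows_def discriminating_row_def)
qed

lemma i_f_eq_Suc_iff:
  "i_f m M j = m + 1 \<longleftrightarrow> clashes m (\<lambda>i. M i j) (\<lambda>i. M i (j + 1)) = {}"
proof -
  let ?C = "clashes m (\<lambda>i. M i j) (\<lambda>i. M i (j + 1))"
  have "Min ?C \<in> ?C" if "?C \<noteq> {}" using that by (intro Min_in) (simp_all add: clashes_def)
  then have "Min ?C \<le> m" if "?C \<noteq> {}" using that by (simp add: clashes_def)
  then show ?thesis by (cases "?C = {}") (simp_all add: i_f_eq Let_def)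
qed

lemma lower_step_entries:
  assumes disj: "S\<^sub>0 \<inter> S\<^sub>1 = {}" and full: "\<And>i. i \<in> {1..m} \<Longrightarrow> pmat (S\<^sub>0, S\<^sub>1) i (j + 1) \<noteq> Free"
  defines "a \<equiv> \<lambda>i. pmat (S\<^sub>0, S\<^sub>1) i j" and "z \<equiv> \<lambda>i. pmat (S\<^sub>0, S\<^sub>1) i (j + 1)"
  assumes ns: "\<not> stuck One m a z"
  obtains T\<^sub>0 T\<^sub>1 where "lower_step m j (S\<^sub>0, S\<^sub>1) = Some (T\<^sub>0, T\<^sub>1)" "T\<^sub>0 \<inter> T\<^sub>1 = {}"
    "\<And>i c. i \<in> {1..m} \<Longrightarrow>
       pmat (T\<^sub>0, T\<^sub>1) i c = (if c = j then best One m a z i else pmat (S\<^sub>0, S\<^sub>1) i c)"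
proof -
  have zfull: "(i, Suc j) \<in> S\<^sub>0 \<or> (i, Suc j) \<in> S\<^sub>1" if "i \<in> {1..m}" for i
    using full[OF that] by (auto simp: pmat.simps split: if_splits)
  have dj: "p \<in> S\<^sub>0 \<Longrightarrow> p \<notin> S\<^sub>1" for p using disj by blast
  show thesis
  proof (cases "clashes m a z = {}")
    case True
    define T\<^sub>0 where "T\<^sub>0 = S\<^sub>0 \<union> {(i, j) | i. i \<in> {1..m} \<and> (i, j) \<notin> S\<^sub>1 \<and> (i, j + 1) \<in> S\<^sub>0}"
    define T\<^sub>1 where "T\<^sub>1 = S\<^sub>1 \<union> {(i, j) | i. i \<in> {1..m} \<and> (i, j) \<notin> S\<^sub>0 \<and> (i, j + 1) \<in> S\<^sub>1}"
    show thesis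
    proof (rule that)
      show "lower_step m j (S\<^sub>0, S\<^sub>1) = Some (T\<^sub>0, T\<^sub>1)"
        using True i_f_eq_Suc_iff[of m "pmat (S\<^sub>0, S\<^sub>1)" j]
        unfolding a_def z_def T\<^sub>0_def T\<^sub>1_def by (simp only: lower_step.simps Let_def simp_thms if_True)
      show "T\<^sub>0 \<inter> T\<^sub>1 = {}" using dj by (fastforce simp: T\<^sub>0_def T\<^sub>1_def)
      show "pmat (T\<^sub>0, T\<^sub>1) i c = (if c = j then best One m a z i else pmat (S\<^sub>0, S\<^sub>1) i c)"
        if i: "i \<in> {1..m}" for i c
      proof (cases "c = j")
        case True
        have "i < pivot One m a z" using \<open>clashes m a z = {}\<close> i by (simp add: pivot_def)
        then have "best One m a z i = (if a i \<noteq> Free then a i else z i)" by (simp add: best_def)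
        then show ?thesis
          using True i zfull[OF i] dj by (auto simp: T\<^sub>0_def T\<^sub>1_def a_def z_def pmat.simps)
      qed (simp add: T\<^sub>0_def T\<^sub>1_def pmat.simps)
    qed
  next
    case False
    define d where "d = pivot One m a z"
    define T\<^sub>1 where "T\<^sub>1 = S\<^sub>1 \<union> {(d, j)} \<union>
      {(i, j) | i. i \<in> {1..m} \<and> (i, j) \<notin> S\<^sub>0 \<and> (i, j + 1) \<in> S\<^sub>1 \<and> i < d}"
    define T\<^sub>0 where "T\<^sub>0 = S\<^sub>0 \<union> {(i, j) | i. i \<in> {1..m} \<and> (i, j) \<notin> T\<^sub>1}"
    have ne: "turning_rows One m a z \<noteq> {}" using ns False by (simp add: stuck_def)
    have d_eq: "d = Max (turning_rows One m a z)" using False by (simp add: d_def pivot_def)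
    have "d \<in> turning_rows One m a z"
      unfolding d_eq using ne by (intro Max_in) (simp_all add: turning_rows_def)
    then have d: "(d, j) \<notin> S\<^sub>0" by (auto simp: turning_rows_def a_def pmat.simps)
    show thesis
    proof (rule that)
      have "i_f m (pmat (S\<^sub>0, S\<^sub>1)) j \<noteq> m + 1" "discriminating_rows m (pmat (S\<^sub>0, S\<^sub>1)) j \<noteq> {}"
          "i_d m (pmat (S\<^sub>0, S\<^sub>1)) j = d"
        using False ne unfolding i_f_eq_Suc_iff i_d_def discriminating_rows_eq d_eq a_def z_def
        by simp_all
      then show "lower_step m j (S\<^sub>0, S\<^sub>1) = Some (T\<^sub>0, T\<^sub>1)"
        unfolding T\<^sub>0_def T\<^sub>1_def by (simp only: lower_step.simps Let_def simp_thms if_False)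
      show "T\<^sub>0 \<inter> T\<^sub>1 = {}" using dj d by (fastforce simp: T\<^sub>0_def T\<^sub>1_def)
      show "pmat (T\<^sub>0, T\<^sub>1) i c = (if c = j then best One m a z i else pmat (S\<^sub>0, S\<^sub>1) i c)"
        if i: "i \<in> {1..m}" for i c
      proof (cases "c = j")
        case True
        have "best One m a z i =
            (if a i \<noteq> Free then a i else if i < d then z i else if i = d then One else Zero)"
          by (simp add: best_def d_def)
        then show ?thesis
          using True i zfull[OF i] dj d by (auto simp: T\<^sub>0_def T\<^sub>1_def a_def z_def pmat.simps)
      qed (simp add: T\<^sub>0_def T\<^sub>1_def pmat.simps)
    qed
  qed
qed

lemma upper_step_entries:
  assumes disj: "S\<^sub>0 \<inter> S\<^sub>1 = {}" and full: "\<And>i. i \<in> {1..m} \<Longrightarrow> pmat (S\<^sub>0, S\<^sub>1) i j \<noteq> Free"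
  defines "a \<equiv> \<lambda>i. pmat (S\<^sub>0, S\<^sub>1) i (j + 1)" and "z \<equiv> \<lambda>i. pmat (S\<^sub>0, S\<^sub>1) i j"
  assumes ns: "\<not> stuck Zero m a z"
  obtains T\<^sub>0 T\<^sub>1 where "upper_step m j (S\<^sub>0, S\<^sub>1) = Some (T\<^sub>0, T\<^sub>1)" "T\<^sub>0 \<inter> T\<^sub>1 = {}"
    "\<And>i c. i \<in> {1..m} \<Longrightarrow>
       pmat (T\<^sub>0, T\<^sub>1) i c = (if c = j + 1 then best Zero m a z i else pmat (S\<^sub>0, S\<^sub>1) i c)"
proof -
  have zfull: "(i, j) \<in> S\<^sub>0 \<or> (i, j) \<in> S\<^sub>1" if "i \<in> {1..m}" for i
    using full[OF that] by (auto simp: pmat.simps split: if_splits)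
  have dj: "p \<in> S\<^sub>0 \<Longrightarrow> p \<notin> S\<^sub>1" for p using disj by blast
  show thesis
  proof (cases "clashes m a z = {}")
    case True
    define T\<^sub>0 where
      "T\<^sub>0 = S\<^sub>0 \<union> {(i, j + 1) | i. i \<in> {1..m} \<and> (i, j + 1) \<notin> S\<^sub>1 \<and> (i, j) \<in> S\<^sub>0}"
    define T\<^sub>1 where
      "T\<^sub>1 = S\<^sub>1 \<union> {(i, j + 1) | i. i \<in> {1..m} \<and> (i, j + 1) \<notin> S\<^sub>0 \<and> (i, j) \<in> S\<^sub>1}"
    show thesis
    proof (rule that)
      show "upper_step m j (S\<^sub>0, S\<^sub>1) = Some (T\<^sub>0, T\<^sub>1)"
        using True[unfolded clashes_commute[of m a]] i_f_eq_Suc_iff[of m "pmat (S\<^sub>0, S\<^sub>1)" j]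
        unfolding a_def z_def T\<^sub>0_def T\<^sub>1_def by (simp only: upper_step.simps Let_def simp_thms if_True)
      show "T\<^sub>0 \<inter> T\<^sub>1 = {}" using dj by (fastforce simp: T\<^sub>0_def T\<^sub>1_def)
      show "pmat (T\<^sub>0, T\<^sub>1) i c = (if c = j + 1 then best Zero m a z i else pmat (S\<^sub>0, S\<^sub>1) i c)"
        if i: "i \<in> {1..m}" for i c
      proof (cases "c = j + 1")
        case True
        have "i < pivot Zero m a z" using \<open>clashes m a z = {}\<close> i by (simp add: pivot_def)
        then have "best Zero m a z i = (if a i \<noteq> Free then a i else z i)" by (simp add: best_def)
        then show ?thesis
          using True i zfull[OF i] dj by (auto simp: T\<^sub>0_def T\<^sub>1_def a_def z_def pmat.simps)
      qed (simp add: T\<^sub>0_def T\<^sub>1_def pmat.simps)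
    qed
  next
    case False
    define d where "d = pivot Zero m a z"
    define T\<^sub>0 where "T\<^sub>0 = S\<^sub>0 \<union> {(d, j + 1)} \<union>
      {(i, j + 1) | i. i \<in> {1..m} \<and> (i, j + 1) \<notin> S\<^sub>1 \<and> (i, j) \<in> S\<^sub>0 \<and> i < d}"
    define T\<^sub>1 where "T\<^sub>1 = S\<^sub>1 \<union> {(i, j + 1) | i. i \<in> {1..m} \<and> (i, j + 1) \<notin> T\<^sub>0}"
    have ne: "turning_rows Zero m a z \<noteq> {}" using ns False by (simp add: stuck_def)
    have d_eq: "d = Max (turning_rows Zero m a z)" using False by (simp add: d_def pivot_def)
    have "d \<in> turning_rows Zero m a z"
      unfolding d_eq using ne by (intro Max_in) (simp_all add: turning_rows_def)
    then have d: "(d, j + 1) \<notin> S\<^sub>1" using dj by (auto simp: turning_rows_def a_def pmat.simps split: if_splits)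
    show thesis
    proof (rule that)
      have "i_f m (pmat (S\<^sub>0, S\<^sub>1)) j \<noteq> m + 1" "discriminating_rows m (pmat (S\<^sub>0, S\<^sub>1)) j \<noteq> {}"
          "i_d m (pmat (S\<^sub>0, S\<^sub>1)) j = d"
        using False[unfolded clashes_commute[of m a]] ne
        unfolding i_f_eq_Suc_iff i_d_def discriminating_rows_eq d_eq a_def z_def turning_rows_Zero
        by simp_all
      then show "upper_step m j (S\<^sub>0, S\<^sub>1) = Some (T\<^sub>0, T\<^sub>1)"
        unfolding T\<^sub>0_def T\<^sub>1_def by (simp only: upper_step.simps Let_def simp_thms if_False)
      show "T\<^sub>0 \<inter> T\<^sub>1 = {}" using dj d by (fastforce simp: T\<^sub>0_def T\<^sub>1_def)
      show "pmat (T\<^sub>0, T\<^sub>1) i c = (if c = j + 1 then best Zero m a z i else pmat (S\<^sub>0, S\<^sub>1) i c)"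
        if i: "i \<in> {1..m}" for i c
      proof (cases "c = j + 1")
        case True
        have "best Zero m a z i =
            (if a i \<noteq> Free then a i else if i < d then z i else if i = d then Zero else One)"
          by (simp add: best_def d_def)
        then show ?thesis
          using True i zfull[OF i] dj d by (auto simp: T\<^sub>0_def T\<^sub>1_def a_def z_def pmat.simps)
      qed (simp add: T\<^sub>0_def T\<^sub>1_def pmat.simps)
    qed
  qed
qed

text \<open>
  A step touches only the column being completed, so a run leaves the prescribed entries in place
  on the columns it has not reached and keeps the greedy columns behind it.
\<close>

lemma lower_run_entries:
  fixes m n :: nat
  assumes disj: "I\<^sub>0 \<inter> I\<^sub>1 = {}"
  defines "a \<equiv> \<lambda>k i. pmat (I\<^sub>0, I\<^sub>1) i (n - k)"
  assumes ns: "\<And>k. Suc k < n \<Longrightarrow> \<not> stuck One m (a (Suc k)) (greedy One m a k)"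
  shows "k < n \<Longrightarrow> \<exists>S\<^sub>0 S\<^sub>1. lower_run m n I\<^sub>0 I\<^sub>1 k = Some (S\<^sub>0, S\<^sub>1) \<and> S\<^sub>0 \<inter> S\<^sub>1 = {} \<and>
    (\<forall>i\<in>{1..m}. \<forall>c. pmat (S\<^sub>0, S\<^sub>1) i c =
       (if n - k \<le> c \<and> c \<le> n then greedy One m a (n - c) i else pmat (I\<^sub>0, I\<^sub>1) i c))"
proof (induction k)
  case 0
  then show ?case using disj by (auto simp: a_def pmat.simps)
next
  case (Suc k)
  let ?g = "greedy One m a"
  obtain S\<^sub>0 S\<^sub>1 where run: "lower_run m n I\<^sub>0 I\<^sub>1 k = Some (S\<^sub>0, S\<^sub>1)" and disj': "S\<^sub>0 \<inter> S\<^sub>1 = {}"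
    and S: "\<And>i c. i \<in> {1..m} \<Longrightarrow> pmat (S\<^sub>0, S\<^sub>1) i c =
       (if n - k \<le> c \<and> c \<le> n then ?g (n - c) i else pmat (I\<^sub>0, I\<^sub>1) i c)"
    using Suc by auto
  define j where "j = n - Suc k"
  have j: "j + 1 = n - k" "n - j = Suc k" "n - (j + 1) = k" "j < n - k" using Suc.prems by (auto simp: j_def)
  have source: "pmat (S\<^sub>0, S\<^sub>1) i (j + 1) = ?g k i" if "i \<in> {1..m}" for i
    using S[OF that] j by simp
  have target: "pmat (S\<^sub>0, S\<^sub>1) i j = a (Suc k) i" if "i \<in> {1..m}" for i
    using S[OF that] j by (simp add: a_def j_def)
  have full: "pmat (S\<^sub>0, S\<^sub>1) i (j + 1) \<noteq> Free" if "i \<in> {1..m}" for i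
    using source[OF that] greedy_completes[of One m a k] that by (simp add: completes_def)
  have "\<not> stuck One m (\<lambda>i. pmat (S\<^sub>0, S\<^sub>1) i j) (\<lambda>i. pmat (S\<^sub>0, S\<^sub>1) i (j + 1))"
    using ns[OF Suc.prems] stuck_cong[OF target source] by simp
  then obtain T\<^sub>0 T\<^sub>1 where step: "lower_step m j (S\<^sub>0, S\<^sub>1) = Some (T\<^sub>0, T\<^sub>1)" "T\<^sub>0 \<inter> T\<^sub>1 = {}"
    and T: "\<And>i c. i \<in> {1..m} \<Longrightarrow> pmat (T\<^sub>0, T\<^sub>1) i c =
       (if c = j then best One m (\<lambda>i. pmat (S\<^sub>0, S\<^sub>1) i j) (\<lambda>i. pmat (S\<^sub>0, S\<^sub>1) i (j + 1)) i
        else pmat (S\<^sub>0, S\<^sub>1) i c)"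
    using lower_step_entries[OF disj' full] by metis
  have "pmat (T\<^sub>0, T\<^sub>1) i c =
      (if n - Suc k \<le> c \<and> c \<le> n then ?g (n - c) i else pmat (I\<^sub>0, I\<^sub>1) i c)" if "i \<in> {1..m}" for i c
  proof (cases "c = j")
    case True
    then show ?thesis using T[OF that, of c] best_cong[OF target source that] j by (simp add: j_def)
  next
    case False
    then show ?thesis using T[OF that, of c] S[OF that, of c] j by (auto simp: j_def)
  qed
  moreover have "lower_run m n I\<^sub>0 I\<^sub>1 (Suc k) = Some (T\<^sub>0, T\<^sub>1)"
    using run step(1) by (simp add: j_def)
  ultimately show ?case using step(2) by blast
qed

lemma upper_run_entries:
  fixes m n :: nat
  assumes disj: "I\<^sub>0 \<inter> I\<^sub>1 = {}"
  defines "a \<equiv> \<lambda>k i. pmat (I\<^sub>0, I\<^sub>1) i (k + 1)"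
  assumes ns: "\<And>k. Suc k < n \<Longrightarrow> \<not> stuck Zero m (a (Suc k)) (greedy Zero m a k)"
  shows "k < n \<Longrightarrow> \<exists>S\<^sub>0 S\<^sub>1. upper_run m I\<^sub>0 I\<^sub>1 k = Some (S\<^sub>0, S\<^sub>1) \<and> S\<^sub>0 \<inter> S\<^sub>1 = {} \<and>
    (\<forall>i\<in>{1..m}. \<forall>c. pmat (S\<^sub>0, S\<^sub>1) i c =
       (if 1 \<le> c \<and> c \<le> k + 1 then greedy Zero m a (c - 1) i else pmat (I\<^sub>0, I\<^sub>1) i c))"
proof (induction k)
  case 0
  then show ?case using disj by (auto simp: a_def pmat.simps)
next
  case (Suc k)
  let ?g = "greedy Zero m a"
  let ?j = "Suc k"
  obtain S\<^sub>0 S\<^sub>1 where run: "upper_run m I\<^sub>0 I\<^sub>1 k = Some (S\<^sub>0, S\<^sub>1)" and disj': "S\<^sub>0 \<inter> S\<^sub>1 = {}"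
    and S: "\<And>i c. i \<in> {1..m} \<Longrightarrow> pmat (S\<^sub>0, S\<^sub>1) i c =
       (if 1 \<le> c \<and> c \<le> k + 1 then ?g (c - 1) i else pmat (I\<^sub>0, I\<^sub>1) i c)"
    using Suc by auto
  have source: "pmat (S\<^sub>0, S\<^sub>1) i ?j = ?g k i" if "i \<in> {1..m}" for i
    using S[OF that] by simp
  have target: "pmat (S\<^sub>0, S\<^sub>1) i (?j + 1) = a (Suc k) i" if "i \<in> {1..m}" for i
    using S[OF that] by (simp add: a_def)
  have full: "pmat (S\<^sub>0, S\<^sub>1) i ?j \<noteq> Free" if "i \<in> {1..m}" for i
    using source[OF that] greedy_completes[of Zero m a k] that by (simp add: completes_def)
  have "\<not> stuck Zero m (\<lambda>i. pmat (S\<^sub>0, S\<^sub>1) i (?j + 1)) (\<lambda>i. pmat (S\<^sub>0, S\<^sub>1) i ?j)"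
    using ns[OF Suc.prems] stuck_cong[OF target source] by simp
  then obtain T\<^sub>0 T\<^sub>1 where step: "upper_step m ?j (S\<^sub>0, S\<^sub>1) = Some (T\<^sub>0, T\<^sub>1)" "T\<^sub>0 \<inter> T\<^sub>1 = {}"
    and T: "\<And>i c. i \<in> {1..m} \<Longrightarrow> pmat (T\<^sub>0, T\<^sub>1) i c =
       (if c = ?j + 1 then best Zero m (\<lambda>i. pmat (S\<^sub>0, S\<^sub>1) i (?j + 1)) (\<lambda>i. pmat (S\<^sub>0, S\<^sub>1) i ?j) i
        else pmat (S\<^sub>0, S\<^sub>1) i c)"
    using upper_step_entries[OF disj' full] by metis
  have "pmat (T\<^sub>0, T\<^sub>1) i c =
      (if 1 \<le> c \<and> c \<le> Suc k + 1 then ?g (c - 1) i else pmat (I\<^sub>0, I\<^sub>1) i c)" if "i \<in> {1..m}" for i c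
  proof (cases "c = ?j + 1")
    case True
    then show ?thesis
      using T[OF that, of c] best_cong[OF target source that] by simp
  next
    case False
    then show ?thesis using T[OF that, of c] S[OF that, of c] by auto
  qed
  moreover have "upper_run m I\<^sub>0 I\<^sub>1 (Suc k) = Some (T\<^sub>0, T\<^sub>1)"
    using run step(1) by simp
  ultimately show ?case using step(2) by blast
qed

section \<open>Sorted completions and their extremal members\<close>

definition sorted_completions :: "nat \<Rightarrow> nat \<Rightarrow> pmatrix \<Rightarrow> pmatrix set" where
  "sorted_completions m n A = {Y.
     (\<forall>j\<in>{1..n}. completes m (\<lambda>i. A i j) (\<lambda>i. Y i j)) \<and>
     (\<forall>j. 1 \<le> j \<and> j < n \<longrightarrow> lex_ge One m (\<lambda>i. Y i j) (\<lambda>i. Y i (j + 1)))}"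

lemma completes_cong:
  assumes "\<And>i. i \<in> {1..m} \<Longrightarrow> y i = y' i"
  shows "completes m a y = completes m a y'"
  using assms by (simp add: completes_def)

lemma lex_ge_Zero: "lex_ge Zero m y z = lex_ge One m z y"
  using lex_ge_opposite[of One m y z] by simp

text \<open>
  A member \<open>Y\<close> is needed even for membership of the lower matrix: it witnesses that the
  construction never fails.
\<close>

lemma lower_matrix_extremal:
  assumes disj: "I\<^sub>0 \<inter> I\<^sub>1 = {}" and Y: "Y \<in> sorted_completions m n (pmat (I\<^sub>0, I\<^sub>1))"
  shows "lower_matrix m n I\<^sub>0 I\<^sub>1 1 \<in> sorted_completions m n (pmat (I\<^sub>0, I\<^sub>1))"
    and "j \<in> {1..n} \<Longrightarrow> lex_ge One m (\<lambda>i. Y i j) (\<lambda>i. lower_matrix m n I\<^sub>0 I\<^sub>1 1 i j)"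
proof -
  define a where "a = (\<lambda>k i. pmat (I\<^sub>0, I\<^sub>1) i (n - k))"
  let ?L = "lower_matrix m n I\<^sub>0 I\<^sub>1 1"
  let ?g = "greedy One m a"
  have y: "completes m (a k) (\<lambda>i. Y i (n - k))" if "k < n" for k
    using Y that by (simp add: sorted_completions_def a_def)
  have sorted: "lex_ge One m (\<lambda>i. Y i (n - Suc k)) (\<lambda>i. Y i (n - k))" if "Suc k < n" for k
  proof -
    have "lex_ge One m (\<lambda>i. Y i (n - Suc k)) (\<lambda>i. Y i ((n - Suc k) + 1))"
      using Y that unfolding sorted_completions_def by simp
    moreover have "(n - Suc k) + 1 = n - k" using that by simp
    ultimately show ?thesis by simp
  qed
  note ext = greedy_extremal[where v = One and n = n and a = a and y = "\<lambda>k i. Y i (n - k)",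
      OF _ y sorted]
  have ns: "\<not> stuck One m (a (Suc k)) (?g k)" if "Suc k < n" for k using ext(2) that by blast
  have L: "?L i j = ?g (n - j) i" if "i \<in> {1..m}" "j \<in> {1..n}" for i j
  proof -
    have "n - 1 < n" using that by simp
    then obtain S\<^sub>0 S\<^sub>1 where "lower_run m n I\<^sub>0 I\<^sub>1 (n - 1) = Some (S\<^sub>0, S\<^sub>1)"
      "\<forall>i\<in>{1..m}. \<forall>c. pmat (S\<^sub>0, S\<^sub>1) i c =
         (if n - (n - 1) \<le> c \<and> c \<le> n then ?g (n - c) i else pmat (I\<^sub>0, I\<^sub>1) i c)"
      using lower_run_entries[where n = n, OF disj ns[unfolded a_def], of "n - 1", folded a_def] by blast
    then show ?thesis using that by (simp add: lower_matrix_def lower_sets_def)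
  qed
  have "completes m (\<lambda>i. pmat (I\<^sub>0, I\<^sub>1) i j) (\<lambda>i. ?L i j)" if j: "j \<in> {1..n}" for j
  proof -
    have "a (n - j) = (\<lambda>i. pmat (I\<^sub>0, I\<^sub>1) i j)" using j by (simp add: a_def)
    then show ?thesis
      using greedy_completes[of One m a "n - j"] completes_cong[OF L[OF _ j]] by simp
  qed
  moreover have "lex_ge One m (\<lambda>i. ?L i j) (\<lambda>i. ?L i (j + 1))" if j: "1 \<le> j" "j < n" for j
  proof -
    have "lex_ge One m (?g (Suc (n - (j + 1)))) (?g (n - (j + 1)))" using j by (intro ext) auto
    moreover have "Suc (n - (j + 1)) = n - j" using j by simp
    moreover have "lex_ge One m (\<lambda>i. ?L i j) (\<lambda>i. ?L i (j + 1)) =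
        lex_ge One m (?g (n - j)) (?g (n - (j + 1)))"
      using j by (intro lex_ge_cong L) auto
    ultimately show ?thesis by (simp only:)
  qed
  ultimately show "?L \<in> sorted_completions m n (pmat (I\<^sub>0, I\<^sub>1))"
    unfolding sorted_completions_def by blast
  show "lex_ge One m (\<lambda>i. Y i j) (\<lambda>i. ?L i j)" if j: "j \<in> {1..n}"
    using ext(1)[of "n - j"] lex_ge_cong[of m _ _ "\<lambda>i. ?L i j" "?g (n - j)", OF refl L[OF _ j]] j by simp
qed

lemma upper_matrix_extremal:
  assumes disj: "I\<^sub>0 \<inter> I\<^sub>1 = {}" and Y: "Y \<in> sorted_completions m n (pmat (I\<^sub>0, I\<^sub>1))"
  shows "upper_matrix m n I\<^sub>0 I\<^sub>1 n \<in> sorted_completions m n (pmat (I\<^sub>0, I\<^sub>1))"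
    and "j \<in> {1..n} \<Longrightarrow> lex_ge One m (\<lambda>i. upper_matrix m n I\<^sub>0 I\<^sub>1 n i j) (\<lambda>i. Y i j)"
proof -
  define a where "a = (\<lambda>k i. pmat (I\<^sub>0, I\<^sub>1) i (k + 1))"
  let ?U = "upper_matrix m n I\<^sub>0 I\<^sub>1 n"
  let ?g = "greedy Zero m a"
  have y: "completes m (a k) (\<lambda>i. Y i (k + 1))" if "k < n" for k
    using Y that by (simp add: sorted_completions_def a_def)
  have sorted: "lex_ge Zero m (\<lambda>i. Y i (Suc k + 1)) (\<lambda>i. Y i (k + 1))" if "Suc k < n" for k
    using Y that unfolding sorted_completions_def lex_ge_Zero by simp
  note ext = greedy_extremal[where v = Zero and n = n and a = a and y = "\<lambda>k i. Y i (k + 1)",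
      OF _ y sorted]
  have ns: "\<not> stuck Zero m (a (Suc k)) (?g k)" if "Suc k < n" for k using ext(2) that by blast
  have U: "?U i j = ?g (j - 1) i" if "i \<in> {1..m}" "j \<in> {1..n}" for i j
  proof -
    have "n - 1 < n" using that by simp
    then obtain S\<^sub>0 S\<^sub>1 where "upper_run m I\<^sub>0 I\<^sub>1 (n - 1) = Some (S\<^sub>0, S\<^sub>1)"
      "\<forall>i\<in>{1..m}. \<forall>c. pmat (S\<^sub>0, S\<^sub>1) i c =
         (if 1 \<le> c \<and> c \<le> n - 1 + 1 then ?g (c - 1) i else pmat (I\<^sub>0, I\<^sub>1) i c)"
      using upper_run_entries[where n = n, OF disj ns[unfolded a_def], of "n - 1", folded a_def] by blast
    then show ?thesis using that by (simp add: upper_matrix_def upper_sets_def)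
  qed
  have "completes m (\<lambda>i. pmat (I\<^sub>0, I\<^sub>1) i j) (\<lambda>i. ?U i j)" if j: "j \<in> {1..n}" for j
  proof -
    have "a (j - 1) = (\<lambda>i. pmat (I\<^sub>0, I\<^sub>1) i j)" using j by (simp add: a_def)
    then show ?thesis
      using greedy_completes[of Zero m a "j - 1"] completes_cong[OF U[OF _ j]] by simp
  qed
  moreover have "lex_ge One m (\<lambda>i. ?U i j) (\<lambda>i. ?U i (j + 1))" if j: "1 \<le> j" "j < n" for j
  proof -
    have "lex_ge Zero m (?g (Suc (j - 1))) (?g (j - 1))" using j by (intro ext) auto
    moreover have "Suc (j - 1) = (j + 1) - 1" using j by simp
    moreover have "lex_ge One m (\<lambda>i. ?U i j) (\<lambda>i. ?U i (j + 1)) =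
        lex_ge One m (?g (j - 1)) (?g ((j + 1) - 1))"
      using j by (intro lex_ge_cong U) auto
    ultimately show ?thesis by (simp only: lex_ge_Zero)
  qed
  ultimately show "?U \<in> sorted_completions m n (pmat (I\<^sub>0, I\<^sub>1))"
    unfolding sorted_completions_def by blast
  show "lex_ge One m (\<lambda>i. ?U i j) (\<lambda>i. Y i j)" if j: "j \<in> {1..n}"
  proof -
    have "j - 1 < n" using j by auto
    then have "lex_ge One m (?g (j - 1)) (\<lambda>i. Y i j)"
      using ext(1)[of "j - 1"] j by (simp add: lex_ge_Zero)
    moreover have "lex_ge One m (\<lambda>i. ?U i j) (\<lambda>i. Y i j) = lex_ge One m (?g (j - 1)) (\<lambda>i. Y i j)"
      using U[OF _ j] by (intro lex_ge_cong) auto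
    ultimately show ?thesis by (simp only:)
  qed
qed

text \<open>
  Upper columns to the left of \<open>j\<close> and lower columns to the right leave room for any completion
  between the two bounds in column \<open>j\<close>.
\<close>

lemma hybrid_sorted_completion:
  assumes L: "L \<in> sorted_completions m n A" and U: "U \<in> sorted_completions m n A"
    and j: "j \<in> {1..n}" and y: "completes m (\<lambda>i. A i j) y"
    and Uy: "lex_ge One m (\<lambda>i. U i j) y" and yL: "lex_ge One m y (\<lambda>i. L i j)"
  shows "(\<lambda>i c. if c < j then U i c else if c = j then y i else L i c) \<in> sorted_completions m n A"
    (is "?H \<in> _")
proof -
  have "completes m (\<lambda>i. A i c) (\<lambda>i. ?H i c)" if "c \<in> {1..n}" for c
    using L U y that by (cases c j rule: linorder_cases) (simp_all add: sorted_completions_def)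
  moreover have "lex_ge One m (\<lambda>i. ?H i c) (\<lambda>i. ?H i (c + 1))" if c: "1 \<le> c" "c < n" for c
  proof -
    have LU: "lex_ge One m (\<lambda>i. L i c) (\<lambda>i. L i (c + 1))"
      "lex_ge One m (\<lambda>i. U i c) (\<lambda>i. U i (c + 1))"
      using L U c by (simp_all add: sorted_completions_def)
    consider "c + 1 < j" | "c + 1 = j" | "c = j" | "c > j" by linarith
    then show ?thesis
    proof cases
      case 1
      then show ?thesis using LU by simp
    next
      case 2
      then have "lex_ge One m (\<lambda>i. U i c) y" using lex_ge_trans[OF _ LU(2), of y] Uy by simp
      then show ?thesis using 2 by auto
    next
      case 3
      then have "lex_ge One m y (\<lambda>i. L i (c + 1))" using lex_ge_trans[OF _ yL] LU(1) by simp
      then show ?thesis using 3 by simp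
    next
      case 4
      then show ?thesis using LU by simp
    qed
  qed
  ultimately show ?thesis unfolding sorted_completions_def by blast
qed

lemma below_first_difference:
  assumes "i < first_difference m L U j" "i \<in> {1..m}"
  shows "L i j = U i j"
proof (rule ccontr)
  assume ne: "L i j \<noteq> U i j"
  then have "first_difference m L U j = Min {i \<in> {1..m}. L i j \<noteq> U i j}"
    using assms(2) by (auto simp: first_difference_def)
  also have "\<dots> \<le> i" using ne assms(2) by (intro Min_le) auto
  finally show False using assms(1) by simp
qed

lemma at_first_difference:
  assumes "first_difference m L U j \<le> m"
  shows "first_difference m L U j \<in> {1..m}"
    and "L (first_difference m L U j) j \<noteq> U (first_difference m L U j) j"
proof -
  have ex: "\<exists>i\<in>{1..m}. L i j \<noteq> U i j" using assms by (auto simp: first_difference_def split: if_splits)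
  then have "Min {i \<in> {1..m}. L i j \<noteq> U i j} \<in> {i \<in> {1..m}. L i j \<noteq> U i j}"
    by (intro Min_in) auto
  then show "first_difference m L U j \<in> {1..m}"
    and "L (first_difference m L U j) j \<noteq> U (first_difference m L U j) j"
    using ex by (simp_all add: first_difference_def)
qed

lemma entry_forced_above_first_difference:
  assumes ULY: "lex_ge One m (\<lambda>i. U i j) (\<lambda>i. Y i j)" "lex_ge One m (\<lambda>i. Y i j) (\<lambda>i. L i j)"
    and i: "i < first_difference m L U j" "i \<in> {1..m}"
  shows "Y i j = L i j"
proof (rule lex_ge_squeeze[OF _ ULY])
  show "U k j = L k j" if "k \<in> {1..i}" for k
    using below_first_difference[of k m L U j] i that by simp
qed (use i in auto)

text \<open>
  In the row of the first difference \<open>L\<close> and \<open>U\<close> already provide both values. Below it, an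
  entry can be flipped in column \<open>j\<close> of \<open>L\<close> from 0 to 1, or in that of \<open>U\<close> from 1 to 0,
  without leaving the interval between the two, since the comparison with the other bound is
  decided in the row of the first difference.
\<close>

lemma entry_free_from_first_difference:
  assumes L: "L \<in> sorted_completions m n A" and U: "U \<in> sorted_completions m n A"
    and UL: "lex_ge One m (\<lambda>i. U i j) (\<lambda>i. L i j)" and j: "j \<in> {1..n}"
    and i: "i \<in> {1..m}" "first_difference m L U j \<le> i" and free: "A i j = Free"
    and v: "v \<noteq> Free"
  shows "\<exists>Y\<in>sorted_completions m n A. Y i j = v"
proof (cases "L i j = v \<or> U i j = v")
  case True
  then show ?thesis using L U by blast
next
  case False
  have cL: "completes m (\<lambda>i. A i j) (\<lambda>i. L i j)" and cU: "completes m (\<lambda>i. A i j) (\<lambda>i. U i j)"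
    using L U j by (simp_all add: sorted_completions_def)
  have LU_i: "L i j = opposite v" "U i j = opposite v"
    using False cL cU i v by (simp_all add: completes_def eq_opposite_iff)
  define d where "d = first_difference m L U j"
  have d: "d \<in> {1..m}" "L d j \<noteq> U d j"
    using at_first_difference[of m L U j] i by (simp_all add: d_def)
  have before: "\<forall>k\<in>{1..<d}. U k j = L k j"
    using below_first_difference[of _ m L U j] d(1) by (auto simp: d_def)
  have "d < i" using d i LU_i by (cases "d = i") (auto simp: d_def)
  have at: "U d j = One" "L d j = Zero"
  proof -
    obtain r where r: "r \<in> {1..m}" "\<forall>k\<in>{1..<r}. U k j = L k j" "U r j = One" "L r j = opposite One"
      using UL d unfolding lex_ge_def by metis
    have "\<not> r < d" "\<not> d < r" using r before d by fastforce+
    then show "U d j = One" "L d j = Zero" using r by simp_all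
  qed
  (* Raising an entry must start from the lower bound, lowering one from the upper bound. *)
  define y where "y = (\<lambda>k. if k = i then v else if v = One then L k j else U k j)"
  have "completes m (\<lambda>i. A i j) y"
    using cL cU free v by (simp add: completes_def y_def)
  moreover have "lex_ge One m (\<lambda>i. U i j) y \<and> lex_ge One m y (\<lambda>i. L i j)"
  proof (cases "v = One")
    case True
    have "(\<forall>k\<in>{1..<d}. U k j = y k) \<and> U d j = One \<and> y d = opposite One"
      using before at \<open>d < i\<close> True by (simp add: y_def)
    moreover have "(\<forall>k\<in>{1..<i}. y k = L k j) \<and> y i = One \<and> L i j = opposite One"
      using LU_i True by (simp add: y_def)
    ultimately show ?thesis unfolding lex_ge_def using d(1) i(1) by blast
  next
    case False
    then have vZ: "v = Zero" using v by (cases v) auto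
    have "(\<forall>k\<in>{1..<i}. U k j = y k) \<and> U i j = One \<and> y i = opposite One"
      using LU_i vZ by (simp add: y_def)
    moreover have "(\<forall>k\<in>{1..<d}. y k = L k j) \<and> y d = One \<and> L d j = opposite One"
      using before at \<open>d < i\<close> vZ by (simp add: y_def)
    ultimately show ?thesis unfolding lex_ge_def using d(1) i(1) by blast
  qed
  ultimately have "(\<lambda>i c. if c < j then U i c else if c = j then y i else L i c)
      \<in> sorted_completions m n A" (is "?H \<in> _")
    using hybrid_sorted_completion[OF L U j] by blast
  then show ?thesis by (rule bexI[rotated]) (simp add: y_def)
qed

section \<open>Binary points of the orbitope as sorted completions\<close>

definition sorted_binary_matrices :: "nat \<Rightarrow> nat \<Rightarrow> (index \<Rightarrow> real) set" where
  "sorted_binary_matrices m n = {X \<in> binary_matrices m n.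
     \<forall>j. 1 \<le> j \<and> j < n \<longrightarrow> lex_geq m (\<lambda>i. X (i, j)) (\<lambda>i. X (i, j + 1))}"

definition entries :: "(index \<Rightarrow> real) \<Rightarrow> pmatrix" where
  "entries X i j = (if X (i, j) = 1 then One else Zero)"

definition of_entries :: "nat \<Rightarrow> nat \<Rightarrow> pmatrix \<Rightarrow> index \<Rightarrow> real" where
  "of_entries m n Y = (\<lambda>(i, j). if (i, j) \<in> grid m n \<and> Y i j = One then 1 else 0)"

lemma lex_geq_iff_lex_ge:
  assumes "\<And>i. i \<in> {1..m} \<Longrightarrow> y' i = (if y i = 1 then One else Zero)"
    and "\<And>i. i \<in> {1..m} \<Longrightarrow> z' i = (if z i = 1 then One else Zero)"
    and "\<And>i. i \<in> {1..m} \<Longrightarrow> y i = 0 \<or> y i = 1" "\<And>i. i \<in> {1..m} \<Longrightarrow> z i = 0 \<or> z i = 1"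
  shows "lex_geq m y z \<longleftrightarrow> lex_ge One m y' z'"
proof -
  have eq: "y i = z i \<longleftrightarrow> y' i = z' i" if "i \<in> {1..m}" for i
    using assms(1,2)[OF that] assms(3,4)[OF that] by auto
  have row: "(\<forall>k\<in>{1..<r}. y k = z k) \<and> y r = 1 \<and> z r = 0 \<longleftrightarrow>
      (\<forall>k\<in>{1..<r}. y' k = z' k) \<and> y' r = One \<and> z' r = opposite One" if r: "r \<in> {1..m}" for r
  proof -
    have "(\<forall>k\<in>{1..<r}. y k = z k) \<longleftrightarrow> (\<forall>k\<in>{1..<r}. y' k = z' k)"
      using eq r by (intro ball_cong) auto
    moreover have "y r = 1 \<longleftrightarrow> y' r = One" "z r = 0 \<longleftrightarrow> z' r = opposite One"
      using assms(1,2)[OF r] assms(4)[OF r] by auto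
    ultimately show ?thesis by blast
  qed
  have "(\<forall>r\<in>{1..m}. y r = z r) \<longleftrightarrow> (\<forall>r\<in>{1..m}. y' r = z' r)" using eq by simp
  then show ?thesis
    unfolding lex_geq_def lex_greater_def lex_ge_def using bex_cong[of "{1..m}" "{1..m}", OF refl row]
    by (simp only:)
qed

lemma entries_sorted_completion:
  assumes X: "X \<in> sorted_binary_matrices m n" and F: "X \<in> cube_face m n I\<^sub>0 I\<^sub>1"
  shows "entries X \<in> sorted_completions m n (pmat (I\<^sub>0, I\<^sub>1))"
proof -
  have bin: "X (i, j) = 0 \<or> X (i, j) = 1" for i j
    using X unfolding sorted_binary_matrices_def binary_matrices_def by blast
  have "X (i, j) = 0" if "(i, j) \<in> I\<^sub>0" for i j using F that by (auto simp: cube_face_def)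
  moreover have "X (i, j) = 1" if "(i, j) \<in> I\<^sub>1" for i j using F that by (auto simp: cube_face_def)
  ultimately have "completes m (\<lambda>i. pmat (I\<^sub>0, I\<^sub>1) i j) (\<lambda>i. entries X i j)" for j
    by (auto simp: completes_def entries_def pmat.simps)
  moreover have "lex_ge One m (\<lambda>i. entries X i j) (\<lambda>i. entries X i (j + 1))" if "1 \<le> j" "j < n" for j
  proof -
    have "lex_geq m (\<lambda>i. X (i, j)) (\<lambda>i. X (i, j + 1))"
      using X that by (simp add: sorted_binary_matrices_def)
    then show ?thesis
      using lex_geq_iff_lex_ge[of m "\<lambda>i. entries X i j" "\<lambda>i. X (i, j)"
          "\<lambda>i. entries X i (j + 1)" "\<lambda>i. X (i, j + 1)"] bin
      by (simp add: entries_def)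
  qed
  ultimately show ?thesis unfolding sorted_completions_def by blast
qed

lemma of_entries_sorted_binary:
  assumes Y: "Y \<in> sorted_completions m n (pmat (I\<^sub>0, I\<^sub>1))"
    and I: "I\<^sub>0 \<subseteq> grid m n" "I\<^sub>1 \<subseteq> grid m n" "I\<^sub>0 \<inter> I\<^sub>1 = {}"
  shows "of_entries m n Y \<in> sorted_binary_matrices m n" "of_entries m n Y \<in> cube_face m n I\<^sub>0 I\<^sub>1"
proof -
  have full: "Y i j \<noteq> Free" "pmat (I\<^sub>0, I\<^sub>1) i j \<noteq> Free \<Longrightarrow> Y i j = pmat (I\<^sub>0, I\<^sub>1) i j"
    if "(i, j) \<in> grid m n" for i j
    using Y that unfolding sorted_completions_def completes_def grid_def by blast+
  have "lex_geq m (\<lambda>i. of_entries m n Y (i, j)) (\<lambda>i. of_entries m n Y (i, j + 1))"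
    if j: "1 \<le> j" "j < n" for j
  proof -
    have "Y i c = (if of_entries m n Y (i, c) = 1 then One else Zero)"
      if "i \<in> {1..m}" "c \<in> {1..n}" for i c
      using full(1)[of i c] that by (cases "Y i c") (auto simp: of_entries_def grid_def)
    then show ?thesis
      using lex_geq_iff_lex_ge[of m "\<lambda>i. Y i j" "\<lambda>i. of_entries m n Y (i, j)"
          "\<lambda>i. Y i (j + 1)" "\<lambda>i. of_entries m n Y (i, j + 1)"] Y j
      by (auto simp: sorted_completions_def of_entries_def)
  qed
  then show "of_entries m n Y \<in> sorted_binary_matrices m n"
    by (auto simp: sorted_binary_matrices_def binary_matrices_def of_entries_def)
  have "of_entries m n Y (i, j) = 0" if "(i, j) \<in> I\<^sub>0" for i j
    using full(2)[of i j] that I by (auto simp: of_entries_def pmat.simps)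
  moreover have "of_entries m n Y (i, j) = 1" if "(i, j) \<in> I\<^sub>1" for i j
    using full(2)[of i j] that I by (auto simp: of_entries_def pmat.simps)
  moreover have "of_entries m n Y \<in> cube m n" by (auto simp: cube_def of_entries_def)
  ultimately show "of_entries m n Y \<in> cube_face m n I\<^sub>0 I\<^sub>1" by (auto simp: cube_face_def)
qed

lemma Fix_full_orbitope:
  assumes "sorted_binary_matrices m n \<inter> F \<noteq> {}"
  defines "V \<equiv> sorted_binary_matrices m n \<inter> F"
  shows "Fix m n F (full_orbitope m n) =
    cube_face m n {p \<in> grid m n. \<forall>X\<in>V. X p = 0} {p \<in> grid m n. \<forall>X\<in>V. X p = 1}"
proof -
  have bin: "sorted_binary_matrices m n \<subseteq> binary_matrices m n"
    by (auto simp: sorted_binary_matrices_def)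
  then have "full_orbitope m n \<inter> F \<inter> binary_matrices m n = V"
    using convex_hull_Int_binary_matrices[OF bin]
    unfolding full_orbitope_def V_def sorted_binary_matrices_def[symmetric] by blast
  moreover have "V \<subseteq> binary_matrices m n" "V \<noteq> {}" using bin assms by auto
  ultimately show ?thesis
    unfolding Fix_def using smallest_cube_face_of_binary_set[of V m n] by simp
qed

theorem theorem2:
  fixes m n :: nat
    and I\<^sub>0 I\<^sub>1 I\<^sub>0_plus I\<^sub>1_plus :: "(nat \<times> nat) set"
    and F :: "(nat \<times> nat \<Rightarrow> real) set"
    and M_lower M_upper :: pmatrix
    and first_diff :: "nat \<Rightarrow> nat"
  assumes "I\<^sub>0 \<subseteq> grid m n" and "I\<^sub>1 \<subseteq> grid m n" and "I\<^sub>0 \<inter> I\<^sub>1 = {}"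
    and "F = cube_face m n I\<^sub>0 I\<^sub>1" and "F \<noteq> {}"
    and "Fix m n F (full_orbitope m n) \<noteq> {}"
    and "M_lower = lower_matrix m n I\<^sub>0 I\<^sub>1 1"
    and "M_upper = upper_matrix m n I\<^sub>0 I\<^sub>1 n"
    and "\<forall>j\<in>{1..n}. first_diff j = first_difference m M_lower M_upper j"
    and "I\<^sub>0_plus = {(i, j) \<in> grid m n - (I\<^sub>0 \<union> I\<^sub>1). i < first_diff j \<and> M_upper i j = Zero}"
    and "I\<^sub>1_plus = {(i, j) \<in> grid m n - (I\<^sub>0 \<union> I\<^sub>1). i < first_diff j \<and> M_lower i j = One}"
  shows "Fix m n F (full_orbitope m n) = cube_face m n (I\<^sub>0 \<union> I\<^sub>0_plus) (I\<^sub>1 \<union> I\<^sub>1_plus)"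
proof -
  note I = assms(1-3)
  define V where "V = sorted_binary_matrices m n \<inter> F"
  define A where "A = pmat (I\<^sub>0, I\<^sub>1)"
  let ?SC = "sorted_completions m n A"
  (* The empty set is a face of the cube, so a nonempty Fix means that V is nonempty. *)
  have "V \<noteq> {}"
  proof
    assume "V = {}"
    then have "full_orbitope m n \<inter> F \<inter> binary_matrices m n \<subseteq> {}"
      using convex_hull_Int_binary_matrices[of "sorted_binary_matrices m n" m n]
      unfolding full_orbitope_def V_def sorted_binary_matrices_def by blast
    then have "Fix m n F (full_orbitope m n) \<subseteq> {}"
      unfolding Fix_def using empty_face_of[of "cube m n"] by blast
    then show False using assms(6) by simp
  qed
  have entries_V: "entries X \<in> ?SC" if "X \<in> V" for X
    using that entries_sorted_completion assms(4) by (simp add: V_def A_def)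
  have of_entries_V: "of_entries m n Y \<in> V" if "Y \<in> ?SC" for Y
    using that of_entries_sorted_binary[of Y, OF _ I] assms(4) by (simp add: V_def A_def)
  have L: "M_lower \<in> ?SC" "\<And>j Y. Y \<in> ?SC \<Longrightarrow> j \<in> {1..n} \<Longrightarrow> lex_ge One m (\<lambda>i. Y i j) (\<lambda>i. M_lower i j)"
    and U: "M_upper \<in> ?SC" "\<And>j Y. Y \<in> ?SC \<Longrightarrow> j \<in> {1..n} \<Longrightarrow> lex_ge One m (\<lambda>i. M_upper i j) (\<lambda>i. Y i j)"
    using \<open>V \<noteq> {}\<close> entries_V lower_matrix_extremal[OF I(3)] upper_matrix_extremal[OF I(3)] assms(7,8)
    unfolding A_def by blast+
  have bin: "X p = 0 \<or> X p = 1" if "X \<in> V" for X p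
    using that unfolding V_def sorted_binary_matrices_def binary_matrices_def by blast
  have fixed: "X p = 0" if "X \<in> V" "p \<in> I\<^sub>0" for X p
    using that assms(4) by (simp add: V_def cube_face_def)
  have fixed': "X p = 1" if "X \<in> V" "p \<in> I\<^sub>1" for X p
    using that assms(4) by (simp add: V_def cube_face_def)
  have forced: "entries X i j = M_lower i j" "M_upper i j = M_lower i j" "M_lower i j \<noteq> Free"
    if "X \<in> V" "(i, j) \<in> grid m n" "i < first_diff j" for X i j
  proof -
    have ij: "i \<in> {1..m}" "j \<in> {1..n}" using that by (auto simp: grid_def)
    then have fd: "i < first_difference m M_lower M_upper j" using that assms(9) by simp
    note Y = entries_V[OF that(1)]
    show eq: "entries X i j = M_lower i j"
      using entry_forced_above_first_difference[of m M_upper j "entries X" M_lower i]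
        U(2)[OF Y ij(2)] L(2)[OF Y ij(2)] fd ij(1) by blast
    show "M_upper i j = M_lower i j" using below_first_difference[OF fd ij(1)] by simp
    show "M_lower i j \<noteq> Free" using eq by (auto simp: entries_def split: if_splits)
  qed
  have free: "\<exists>X\<in>V. X (i, j) = (if v = One then 1 else 0)"
    if ij: "(i, j) \<in> grid m n - (I\<^sub>0 \<union> I\<^sub>1)" "\<not> i < first_diff j" and v: "v \<noteq> Free" for i j v
  proof -
    have "i \<in> {1..m}" "j \<in> {1..n}" "A i j = Free" using ij by (auto simp: grid_def A_def pmat.simps)
    then obtain Y where Y: "Y \<in> ?SC" "Y i j = v"
      using entry_free_from_first_difference[OF L(1) U(1) U(2)[OF L(1)], of j i v] ij v assms(9)
      by auto
    have "of_entries m n Y (i, j) = (if v = One then 1 else 0)"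
      using Y(2) ij by (simp add: of_entries_def)
    then show ?thesis using of_entries_V[OF Y(1)] by blast
  qed
  have zeros: "{p \<in> grid m n. \<forall>X\<in>V. X p = 0} = I\<^sub>0 \<union> I\<^sub>0_plus"
  proof (intro equalityI subsetI)
    fix p assume p: "p \<in> {p \<in> grid m n. \<forall>X\<in>V. X p = 0}"
    obtain i j where ij: "p = (i, j)" by fastforce
    obtain X where X: "X \<in> V" using \<open>V \<noteq> {}\<close> by blast
    have "p \<notin> I\<^sub>1" using p X fixed' by fastforce
    moreover have "i < first_diff j \<and> M_upper i j = Zero" if "p \<notin> I\<^sub>0"
    proof
      show lt: "i < first_diff j"
        using free[of i j One] p ij that \<open>p \<notin> I\<^sub>1\<close> by (force split: if_splits)
      have "X (i, j) = 0" using p ij X by blast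
      then show "M_upper i j = Zero" using forced[OF X, of i j] lt p ij by (simp add: entries_def)
    qed
    ultimately show "p \<in> I\<^sub>0 \<union> I\<^sub>0_plus" using p ij assms(10) by auto
  next
    fix p assume p: "p \<in> I\<^sub>0 \<union> I\<^sub>0_plus"
    have "X p = 0" if X: "X \<in> V" for X
      using p fixed[OF X] forced[OF X] bin[OF X] assms(10)
      by (cases p) (fastforce simp: entries_def split: if_splits)
    then show "p \<in> {p \<in> grid m n. \<forall>X\<in>V. X p = 0}" using p I assms(10) by auto
  qed
  have ones: "{p \<in> grid m n. \<forall>X\<in>V. X p = 1} = I\<^sub>1 \<union> I\<^sub>1_plus"
  proof (intro equalityI subsetI)
    fix p assume p: "p \<in> {p \<in> grid m n. \<forall>X\<in>V. X p = 1}"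
    obtain i j where ij: "p = (i, j)" by fastforce
    obtain X where X: "X \<in> V" using \<open>V \<noteq> {}\<close> by blast
    have "p \<notin> I\<^sub>0" using p X fixed by fastforce
    moreover have "i < first_diff j \<and> M_lower i j = One" if "p \<notin> I\<^sub>1"
    proof
      show lt: "i < first_diff j"
        using free[of i j Zero] p ij that \<open>p \<notin> I\<^sub>0\<close> by (force split: if_splits)
      have "X (i, j) = 1" using p ij X by blast
      then show "M_lower i j = One" using forced[OF X, of i j] lt p ij by (simp add: entries_def)
    qed
    ultimately show "p \<in> I\<^sub>1 \<union> I\<^sub>1_plus" using p ij assms(11) by auto
  next
    fix p assume p: "p \<in> I\<^sub>1 \<union> I\<^sub>1_plus"
    have "X p = 1" if X: "X \<in> V" for X
      using p fixed'[OF X] forced[OF X] assms(11)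
      by (cases p) (fastforce simp: entries_def split: if_splits)
    then show "p \<in> {p \<in> grid m n. \<forall>X\<in>V. X p = 1}" using p I assms(11) by auto
  qed
  show ?thesis
    using Fix_full_orbitope[of m n F, folded V_def] \<open>V \<noteq> {}\<close> unfolding zeros ones by blast
qed

end
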